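(* Fix $V>0$ and run the proposed algorithm with parameter $V$ on the $N$ renewal systems described in the context, and let $\{y^n[t]\}_{t\ge 0}$ and $\{\mathbf z^n[t]\}_{t\ge 0}$, $n\in\{1,\dots,N\}$, be the resulting processes. Then all constraints are satisfied, i.e. $$\limsup_{T\to\infty}\frac1T\sum_{t=0}^{T-1}\sum_{n=1}^N\mathbb E\left(z^n_l[t]\right)\le d_l,\qquad l\in\{1,\dots,L\},$$ and $O(1/V)$ near optimality is achieved, i.e. $$\limsup_{T\to\infty}\frac1T\sum_{t=0}^{T-1}\sum_{n=1}^N\mathbb E\left(y^n[t]\right)\le f_*+\frac{NC_1+C_3}{V},$$ where $C_1:=6Lz_{\max}(Nz_{\max}+d_{\max})B$ and $C_3:=\frac12(Nz_{\max}+d_{\max})^2L$.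
   Context: Renewal systems. There are $N$ systems on slotted time $t\in\{0,1,2,\dots\}$. System $n$ has renewal times $0=t^n_0<t^n_1<t^n_2<\cdots$ (integer slots); $T^n_k:=t^n_{k+1}-t^n_k\ge 1$ is the length of frame $k$ and $\mathcal T^n_k:=\{t^n_k,\dots,t^n_{k+1}-1\}$. At slot $t^n_k$ system $n$ chooses a (possibly random, possibly past-dependent) action $\alpha^n_k$ in a set $\mathcal A^n$. The action determines the distribution of $T^n_k$ and, for $t\in\mathcal T^n_k$, of a penalty $y^n[t]\in\mathbb R$ and a metric vector $\mathbf z^n[t]=(z^n_1[t],\dots,z^n_L[t])\in\mathbb R^L$. Renewal property: given $\alpha^n_k=\alpha^n$, the variables $T^n_k$, $y^n[t]$, $\mathbf z^n[t]$ ($t\in\mathcal T^n_k$) are independent of all outcomes (of all systems and of the external process below) from slots before $t^n_k$, and the conditional expectations $\widehat T^n(\alpha^n):=\mathbb E(T^n_k\mid\alpha^n_k=\alpha^n)$, $\widehat y^n(\alpha^n):=\mathbb E(\sum_{t\in\mathcal T^n_k}y^n[t]\mid\alpha^n_k=\alpha^n)$, $\widehat z^n_l(\alpha^n):=\mathbb E(\sum_{t\in\mathcal T^n_k}z^n_l[t]\mid\alpha^n_k=\alpha^n)$ do not depend on $k$. Put $\widehat f^n:=\widehat y^n/\widehat T^n$ and $\widehat{\mathbf g}^n:=\widehat{\mathbf z}^n/\widehat T^n$. External process. $\{\mathbf d[t]\}_{t\ge0}\subset\mathbb R^L$ is an uncontrollable external i.i.d. process with $d_l:=\mathbb E(d_l[t])$;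 $\mathbf d[t]$ is independent of all outcomes from slots before $t$ (in particular of $\mathbf Q[t]$ below). Optimization problem. Minimize $\limsup_{T\to\infty}\frac1T\sum_{t=0}^{T-1}\sum_{n=1}^N\mathbb E(y^n[t])$ subject to $\limsup_{T\to\infty}\frac1T\sum_{t=0}^{T-1}\sum_{n=1}^N\mathbb E(z^n_l[t])\le d_l$ for $l=1,\dots,L$, over all decision sequences. $f_*$ denotes the infimum of the objective over all decision sequences satisfying the constraints. Standing assumptions. (1) Feasibility: some decision sequences satisfy the constraints. (2) Boundedness: there are constants with $|y^n[t]|\le y_{\max}$, $|z^n_l[t]|\le z_{\max}$, $|d_l[t]|\le d_{\max}$ for all $n,l,t$; and there is a constant $B\ge1$ such that for all $n,k$, all $\alpha^n\in\mathcal A^n$ and all $s\in\mathbb N=\{0,1,\dots\}$ with $\Pr(T^n_k\ge s\mid\alpha^n_k=\alpha^n)>0$, $\mathbb E\left((T^n_k-s)^2\mid\alpha^n_k=\alpha^n,\,T^n_k\ge s\right)\le B$. (3) Compactness: for each $n$ the set $\{(\widehat f^n(\alpha^n),\widehat{\mathbf g}^n(\alpha^n)):\alpha^n\in\mathcal A^n\}\subset\mathbb R^{L+1}$ is compact. Proposed algorithm (parameter $V>0$). Virtual queues $\mathbf Q[t]=(Q_1[t],\dots,Q_L[t])$ start at $\mathbf Q[0]=0$ and are updated every slot by $Q_l[t+1]=\max\{Q_l[t]+\sum_{n=1}^Nz^n_l[t]-d_l[t],\,0\}$. At the beginning of each frame $k$ of system $n$, the system observes $\mathbf Q[t^n_k]$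 and chooses $\alpha^n_k\in\mathcal A^n$ (determined by $\mathbf Q[t^n_k]$) attaining $\min_{\alpha^n\in\mathcal A^n}\{V\widehat f^n(\alpha^n)+\langle\mathbf Q[t^n_k],\widehat{\mathbf g}^n(\alpha^n)\rangle\}$. *)

theory Defs
  imports "HOL-Probability.Probability"
begin

text \<open>
  Systems are indexed by a finite type \<open>'n\<close> (so \<open>N = CARD('n)\<close>), metrics by a finite type \<open>'l\<close>
  (so \<open>L = CARD('l)\<close>). The outcome of one frame is a pair \<open>(T, p)\<close>: \<open>T\<close> is the frame length and
  \<open>p i\<close>, for \<open>i < T\<close>, is the pair (penalty, metric vector) in the \<open>i\<close>-th slot of the frame.
  Beyond the end of the frame, \<open>p\<close> is padded with zeros.
\<close>

type_synonym 'l frame = "nat \<times> (nat \<Rightarrow> real \<times> (real ^ 'l))"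

definition frame_space :: "'l::finite frame measure" where
  "frame_space = count_space UNIV \<Otimes>\<^sub>M (\<Pi>\<^sub>M i\<in>UNIV. borel)"


section \<open>Renewal systems\<close>

definition mean_length :: "('a \<Rightarrow> 'l::finite frame measure) \<Rightarrow> 'a \<Rightarrow> real" where
  "mean_length \<kappa> a = (\<integral>x. real (fst x) \<partial>\<kappa> a)"

definition mean_penalty :: "('a \<Rightarrow> 'l::finite frame measure) \<Rightarrow> 'a \<Rightarrow> real" where
  "mean_penalty \<kappa> a = (\<integral>x. (\<Sum>i<fst x. fst (snd x i)) \<partial>\<kappa> a)"

definition mean_metric :: "('a \<Rightarrow> 'l::finite frame measure) \<Rightarrow> 'a \<Rightarrow> real ^ 'l" where
  "mean_metric \<kappa> a = (\<integral>x. (\<Sum>i<fst x. snd (snd x i)) \<partial>\<kappa> a)"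

definition penalty_rate :: "('a \<Rightarrow> 'l::finite frame measure) \<Rightarrow> 'a \<Rightarrow> real" where
  "penalty_rate \<kappa> a = mean_penalty \<kappa> a / mean_length \<kappa> a"

definition metric_rate :: "('a \<Rightarrow> 'l::finite frame measure) \<Rightarrow> 'a \<Rightarrow> real ^ 'l" where
  "metric_rate \<kappa> a = mean_metric \<kappa> a /\<^sub>R mean_length \<kappa> a"

text \<open>
  \<open>space (A n)\<close> is the action set of system \<open>n\<close>; \<open>K n k a\<close> is the law of the outcome of frame \<open>k\<close>
  of system \<open>n\<close> when action \<open>a\<close> is chosen, i.e. conditional expectations given
  \<open>\<alpha>\<^sup>n\<^sub>k = a\<close> are integrals with respect to \<open>K n k a\<close>; \<open>D\<close> is the common law of the external process.
  Only the three means are required to be the same for all frames, so the rates of system \<open>n\<close> may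
  be computed from \<open>K n 0\<close>.
\<close>

locale renewal_systems =
  fixes A :: "'n::finite \<Rightarrow> 'a measure"
    and K :: "'n \<Rightarrow> nat \<Rightarrow> 'a \<Rightarrow> 'l::finite frame measure"
    and D :: "(real ^ 'l) measure"
  assumes kernel: "K n k \<in> A n \<rightarrow>\<^sub>M prob_algebra frame_space"
    and frame_wf: "a \<in> space (A n) \<Longrightarrow>
      AE x in K n k a. fst x \<ge> 1 \<and> (\<forall>i\<ge>fst x. snd x i = 0)"
    and mean_length_indep: "a \<in> space (A n) \<Longrightarrow> mean_length (K n k) a = mean_length (K n 0) a"
    and mean_penalty_indep: "a \<in> space (A n) \<Longrightarrow> mean_penalty (K n k) a = mean_penalty (K n 0) a"
    and mean_metric_indep: "a \<in> space (A n) \<Longrightarrow> mean_metric (K n k) a = mean_metric (K n 0) a"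
    and external_law: "prob_space D" "sets D = sets borel"

text \<open>
  In the residual life bound, \<open>uniform_measure (K n k a) {x. fst x \<ge> s}\<close> is the conditional law given
  \<open>T \<ge> s\<close>. The expectation is a nonnegative integral, so that the bound includes its existence.
\<close>

definition bounded_systems ::
  "('n::finite \<Rightarrow> 'a measure) \<Rightarrow> ('n \<Rightarrow> nat \<Rightarrow> 'a \<Rightarrow> 'l::finite frame measure) \<Rightarrow>
    (real ^ 'l) measure \<Rightarrow> real \<Rightarrow> real \<Rightarrow> real \<Rightarrow> real \<Rightarrow> bool" where
  "bounded_systems A K D ymax zmax dmax B \<longleftrightarrow>
     (\<forall>n k. \<forall>a\<in>space (A n). AE x in K n k a. \<forall>i<fst x.
        \<bar>fst (snd x i)\<bar> \<le> ymax \<and> (\<forall>l. \<bar>snd (snd x i) $ l\<bar> \<le> zmax)) \<and>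
     (AE x in D. \<forall>l. \<bar>x $ l\<bar> \<le> dmax) \<and>
     B \<ge> 1 \<and>
     (\<forall>n k. \<forall>a\<in>space (A n). \<forall>s.
        measure (K n k a) {x \<in> space (K n k a). fst x \<ge> s} > 0 \<longrightarrow>
        (\<integral>\<^sup>+x. ennreal ((real (fst x) - real s)\<^sup>2)
           \<partial>uniform_measure (K n k a) {x \<in> space (K n k a). fst x \<ge> s}) \<le> ennreal B)"

definition compact_rates ::
  "('n::finite \<Rightarrow> 'a measure) \<Rightarrow> ('n \<Rightarrow> nat \<Rightarrow> 'a \<Rightarrow> 'l::finite frame measure) \<Rightarrow> bool" where
  "compact_rates A K \<longleftrightarrow>
     (\<forall>n. compact ((\<lambda>a. (penalty_rate (K n 0) a, metric_rate (K n 0) a)) ` space (A n)))"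


section \<open>Decision sequences\<close>

definition frame_outcome ::
  "('n \<Rightarrow> nat \<Rightarrow> 'w \<Rightarrow> nat) \<Rightarrow> ('n \<Rightarrow> nat \<Rightarrow> 'w \<Rightarrow> real) \<Rightarrow> ('n \<Rightarrow> nat \<Rightarrow> 'w \<Rightarrow> real ^ 'l) \<Rightarrow>
    'n \<Rightarrow> nat \<Rightarrow> 'w \<Rightarrow> 'l::finite frame" where
  "frame_outcome \<tau> y z n k \<omega> =
     (\<tau> n (Suc k) \<omega> - \<tau> n k \<omega>,
      \<lambda>i. if i < \<tau> n (Suc k) \<omega> - \<tau> n k \<omega> then (y n (\<tau> n k \<omega> + i) \<omega>, z n (\<tau> n k \<omega> + i) \<omega>) else 0)"

text \<open>
  A decision sequence together with the processes it produces, on a probability space \<open>M\<close>: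
  \<open>\<tau> n k\<close> is the renewal time \<open>t\<^sup>n\<^sub>k\<close>, \<open>\<alpha> n k\<close> the action taken there, \<open>y n t\<close>, \<open>z n t\<close> the penalty and
  metric vector of system \<open>n\<close> in slot \<open>t\<close>, and \<open>d t\<close> the external process. The \<open>\<sigma>\<close>-algebra \<open>F t\<close> is the
  information on which the decisions at the beginning of slot \<open>t\<close> are based: it contains all
  outcomes of slots before \<open>t\<close> and may contain private randomization, so decisions may be random and
  depend on the past, but cannot anticipate the future. The joint law of different systems, and of
  the systems and the external process, within a slot is not restricted.

  The assumption \<open>renewal\<close> says that on the event that frame \<open>k\<close> of system \<open>n\<close> starts in slot \<open>s\<close>, the
  conditional law of its outcome given \<open>F s\<close> is \<open>K n k (\<alpha> n k)\<close>. In particular, given the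
  action, the outcome is independent of everything that happened before slot \<open>s\<close>.
\<close>

locale decision_sequence =
  renewal_systems A K D + prob_space M + filtration "space M" F
  for A :: "'n::finite \<Rightarrow> 'a measure"
    and K :: "'n \<Rightarrow> nat \<Rightarrow> 'a \<Rightarrow> 'l::finite frame measure"
    and D :: "(real ^ 'l) measure"
    and M :: "'w measure"
    and F :: "nat \<Rightarrow> 'w measure" +
  fixes \<tau> :: "'n \<Rightarrow> nat \<Rightarrow> 'w \<Rightarrow> nat"
    and \<alpha> :: "'n \<Rightarrow> nat \<Rightarrow> 'w \<Rightarrow> 'a"
    and y :: "'n \<Rightarrow> nat \<Rightarrow> 'w \<Rightarrow> real"
    and z :: "'n \<Rightarrow> nat \<Rightarrow> 'w \<Rightarrow> real ^ 'l"
    and d :: "nat \<Rightarrow> 'w \<Rightarrow> real ^ 'l"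
  assumes subalgebra: "subalgebra M (F t)"
    and renewal_time_0: "\<omega> \<in> space M \<Longrightarrow> \<tau> n 0 \<omega> = 0"
    and renewal_time_less: "\<omega> \<in> space M \<Longrightarrow> \<tau> n k \<omega> < \<tau> n (Suc k) \<omega>"
    and renewal_time_stopping: "stopping_time F (\<tau> n k)"
    and action_mem: "\<omega> \<in> space M \<Longrightarrow> \<alpha> n k \<omega> \<in> space (A n)"
    and action_adapted: "U \<in> sets (A n) \<Longrightarrow>
      {\<omega> \<in> space M. \<tau> n k \<omega> = s \<and> \<alpha> n k \<omega> \<in> U} \<in> sets (F s)"
    and penalty_adapted: "y n t \<in> borel_measurable (F (Suc t))"
    and metric_adapted: "z n t \<in> borel_measurable (F (Suc t))"
    and external_adapted: "d t \<in> borel_measurable (F (Suc t))"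
    and renewal: "E \<in> sets (F s) \<Longrightarrow> E \<subseteq> {\<omega> \<in> space M. \<tau> n k \<omega> = s} \<Longrightarrow> S \<in> sets frame_space \<Longrightarrow>
      emeasure M {\<omega> \<in> E. frame_outcome \<tau> y z n k \<omega> \<in> S} =
      (\<integral>\<^sup>+\<omega>\<in>E. emeasure (K n k (\<alpha> n k \<omega>)) S \<partial>M)"
    and external_distr: "distr M borel (d t) = D"
    and external_indep: "indep_set (sets (F t)) {d t -` S \<inter> space M | S. S \<in> sets borel}"


section \<open>The optimization problem\<close>

definition avg_penalty :: "'w measure \<Rightarrow> ('n::finite \<Rightarrow> nat \<Rightarrow> 'w \<Rightarrow> real) \<Rightarrow> ereal" where
  "avg_penalty M y =
     limsup (\<lambda>T. ereal (1 / real T * (\<Sum>t<T. \<Sum>n\<in>UNIV. (\<integral>\<omega>. y n t \<omega> \<partial>M))))"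

definition avg_metric ::
  "'w measure \<Rightarrow> ('n::finite \<Rightarrow> nat \<Rightarrow> 'w \<Rightarrow> real ^ 'l::finite) \<Rightarrow> 'l \<Rightarrow> ereal" where
  "avg_metric M z l =
     limsup (\<lambda>T. ereal (1 / real T * (\<Sum>t<T. \<Sum>n\<in>UNIV. (\<integral>\<omega>. z n t \<omega> $ l \<partial>M))))"

definition constraints_satisfied ::
  "(real ^ 'l::finite) measure \<Rightarrow> 'w measure \<Rightarrow> ('n::finite \<Rightarrow> nat \<Rightarrow> 'w \<Rightarrow> real ^ 'l) \<Rightarrow> bool" where
  "constraints_satisfied D M z \<longleftrightarrow> (\<forall>l. avg_metric M z l \<le> ereal (\<integral>x. x $ l \<partial>D))"

text \<open>
  The type argument \<open>'v\<close> is the type of the sample points of the probability spaces carrying the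
  competing decision sequences, since HOL cannot quantify over types inside a formula. Results about
  \<open>opt_value\<close> should be stated for all \<open>'v\<close>, independently of the sample space on which the algorithm is
  run; they then cover decision sequences on arbitrary probability spaces.
\<close>

definition feasible_values ::
  "'v itself \<Rightarrow> ('n::finite \<Rightarrow> 'a measure) \<Rightarrow> ('n \<Rightarrow> nat \<Rightarrow> 'a \<Rightarrow> 'l::finite frame measure) \<Rightarrow>
    (real ^ 'l) measure \<Rightarrow> ereal set" where
  "feasible_values _ A K D =
     {avg_penalty M y | (M :: 'v measure) F \<tau> \<alpha> y z d.
        decision_sequence A K D M F \<tau> \<alpha> y z d \<and> constraints_satisfied D M z}"

definition opt_value ::
  "'v itself \<Rightarrow> ('n::finite \<Rightarrow> 'a measure) \<Rightarrow> ('n \<Rightarrow> nat \<Rightarrow> 'a \<Rightarrow> 'l::finite frame measure) \<Rightarrow>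
    (real ^ 'l) measure \<Rightarrow> ereal" where
  "opt_value TV A K D = Inf (feasible_values TV A K D)"


section \<open>The proposed algorithm\<close>

primrec queue ::
  "('n::finite \<Rightarrow> nat \<Rightarrow> 'w \<Rightarrow> real ^ 'l::finite) \<Rightarrow> (nat \<Rightarrow> 'w \<Rightarrow> real ^ 'l) \<Rightarrow> nat \<Rightarrow> 'w \<Rightarrow> real ^ 'l"
where
  "queue z d 0 \<omega> = 0"
| "queue z d (Suc t) \<omega> =
     (\<chi> l. max (queue z d t \<omega> $ l + (\<Sum>n\<in>UNIV. z n t \<omega> $ l) - d t \<omega> $ l) 0)"

definition proposed_algorithm ::
  "real \<Rightarrow> ('n::finite \<Rightarrow> 'a measure) \<Rightarrow> ('n \<Rightarrow> nat \<Rightarrow> 'a \<Rightarrow> 'l::finite frame measure) \<Rightarrow>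
    'w measure \<Rightarrow> ('n \<Rightarrow> nat \<Rightarrow> 'w \<Rightarrow> nat) \<Rightarrow> ('n \<Rightarrow> nat \<Rightarrow> 'w \<Rightarrow> 'a) \<Rightarrow>
    ('n \<Rightarrow> nat \<Rightarrow> 'w \<Rightarrow> real ^ 'l) \<Rightarrow> (nat \<Rightarrow> 'w \<Rightarrow> real ^ 'l) \<Rightarrow> bool" where
  "proposed_algorithm V A K M \<tau> \<alpha> z d \<longleftrightarrow>
     (\<exists>choice. \<forall>n k. \<forall>\<omega>\<in>space M.
        let q = queue z d (\<tau> n k \<omega>) \<omega> in
          \<alpha> n k \<omega> = choice n k q \<and>
          is_arg_min (\<lambda>a. V * penalty_rate (K n 0) a + q \<bullet> metric_rate (K n 0) a)
            (\<lambda>a. a \<in> space (A n)) (\<alpha> n k \<omega>))"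

end

theory Submission
  imports Defs
begin

text \<open>
  For a price vector \<open>q \<ge> 0\<close> let \<open>m\<^sub>n(q)\<close> be the least value of \<open>V * penalty rate + q \<bullet> metric rate\<close> over
  the actions of system \<open>n\<close>. The proof compares the algorithm with an arbitrary feasible decision
  sequence through these numbers only.

  \<^item> A lower bound for every feasible sequence (\<open>min_cost_le_feasible\<close>): charge the fixed prices \<open>q\<close>. By the
    renewal property a frame with action \<open>a\<close> costs on average its mean length times a rate that is at least
    \<open>m\<^sub>n(q)\<close>. Summing over frames, letting time go to infinity and using the constraints gives
    \<open>\<Sum>n. m\<^sub>n(q) \<le> V r + \<langle>q, d\<rangle>\<close> for every \<open>r\<close> above the average penalty of the sequence.
  \<^item> An upper bound for the algorithm (\<open>greedy_cost\<close>): its actions attain \<open>m\<^sub>n(Q[s])\<close> for the prices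
    \<open>Q[s]\<close> at the start \<open>s\<close> of the frame. If the prices stayed frozen during a frame, the excess of
    the frame cost over \<open>m\<^sub>n\<close> would have mean zero. As the queues move by at most
    \<open>c = N zmax + dmax\<close> per slot and \<open>m\<^sub>n\<close> is Lipschitz, unfreezing the prices in a frame of length \<open>T\<close> costs at
    most \<open>2 L zmax c T\<^sup>2\<close>, whose mean is at most \<open>2 L zmax c B \<le> C1\<close>; and at most one frame starts in each slot.
  \<^item> Drift (\<open>drift_plus_penalty\<close>): \<open>\<bar>Q[t]\<bar>\<^sup>2 / 2\<close> grows by at most \<open>C3 + \<langle>Q[t], \<Sum>n. z\<^sup>n[t] - d[t]\<rangle>\<close>, and \<open>d[t]\<close> is
    independent of \<open>Q[t]\<close>. Inserting the first bound at the random prices \<open>q = Q[t]\<close> and then the second yields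
    \<open>V * expected penalty up to T + E \<bar>Q[T]\<bar>\<^sup>2 / 4 \<le> (V r + N C1 + C3) T + O(1)\<close>.

  Dividing by \<open>V T\<close> gives near optimality. Since penalties are bounded, the same inequality shows
  \<open>E \<bar>Q[T]\<bar>\<^sup>2 = O(T)\<close>, hence \<open>E Q\<^sub>l[T] = O(\<surd>T)\<close>, which bounds the violation of the constraints up to
  time \<open>T\<close>.

  The delicate point is the frame in progress at time \<open>T\<close>: full frames are needed for the renewal property, and
  the slots beyond \<open>T\<close> are charged at prices of order \<open>\<bar>Q[T]\<bar>\<close>, which is not bounded in \<open>T\<close>. By the residual
  life assumption the overshoot has second moment at most \<open>B\<close> (\<open>overshoot_sq_expectation\<close>), so by Young's
  inequality its price is absorbed by a quarter of \<open>E \<bar>Q[T]\<bar>\<^sup>2\<close> up to a constant.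
\<close>

section \<open>Slots and frames of a single path\<close>

lemma sum_frames_eq_sum_slots:
  fixes \<tau> :: "nat \<Rightarrow> nat" and v :: "nat \<Rightarrow> real"
  assumes "\<tau> 0 = 0" and step: "\<And>k. \<tau> k < \<tau> (Suc k)"
  shows "(\<Sum>k<m. \<Sum>i<\<tau> (Suc k) - \<tau> k. v (\<tau> k + i)) = (\<Sum>t<\<tau> m. v t)"
proof (induction m)
  case 0
  then show ?case using assms by simp
next
  case (Suc m)
  have "(\<Sum>t<\<tau> (Suc m). v t) = (\<Sum>t<\<tau> m. v t) + (\<Sum>t=\<tau> m..<\<tau> (Suc m). v t)"
    using step[of m] sum.atLeastLessThan_concat[of 0 "\<tau> m" "\<tau> (Suc m)" v]
    by (simp add: atLeast0LessThan)
  also have "(\<Sum>t=\<tau> m..<\<tau> (Suc m). v t) = (\<Sum>i<\<tau> (Suc m) - \<tau> m. v (\<tau> m + i))"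
    using sum.shift_bounds_nat_ivl[of v 0 "\<tau> m" "\<tau> (Suc m) - \<tau> m"] step[of m]
    by (simp add: atLeast0LessThan add.commute)
  finally show ?case using Suc by simp
qed

lemma renewal_index_le_time:
  fixes \<tau> :: "nat \<Rightarrow> nat"
  assumes step: "\<And>k. \<tau> k < \<tau> (Suc k)"
  shows "k \<le> \<tau> k"
proof (induction k)
  case (Suc k)
  then show ?case using step[of k] by simp
qed simp

lemma sum_slots_eq_sum_frames:
  fixes \<tau> :: "nat \<Rightarrow> nat" and v :: "nat \<Rightarrow> real"
  assumes "\<tau> 0 = 0" and step: "\<And>k. \<tau> k < \<tau> (Suc k)"
  shows "(\<Sum>t<T. v t) =
    (\<Sum>k<T. \<Sum>i<\<tau> (Suc k) - \<tau> k. if \<tau> k + i < T then v (\<tau> k + i) else 0)"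
proof -
  have "T \<le> \<tau> T" using step by (rule renewal_index_le_time)
  have "(\<Sum>k<T. \<Sum>i<\<tau> (Suc k) - \<tau> k. if \<tau> k + i < T then v (\<tau> k + i) else 0) =
      (\<Sum>t<\<tau> T. if t < T then v t else 0)"
    using sum_frames_eq_sum_slots[OF assms, of "\<lambda>t. if t < T then v t else 0" T] .
  also have "\<dots> = (\<Sum>t<T. v t)"
    using \<open>T \<le> \<tau> T\<close> by (intro sum.mono_neutral_cong_right) auto
  finally show ?thesis by simp
qed

text \<open>
  The path-wise comparison behind both halves of the proof. Here \<open>\<psi> t s\<close> is the cost of slot \<open>t\<close> at the prices
  of slot \<open>s\<close>. A slot before \<open>T\<close> contributes the change of prices since the start of its frame. A slot from
  \<open>T\<close> on is surplus and contributes its whole frozen cost, which is compared with the cost at the prices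
  of time \<open>T\<close> because these are the ones that the drift inequality controls. Either way the price change
  is charged once per slot, which gives the square of the frame length.
\<close>
lemma freeze_prices_in_frames:
  fixes \<tau> :: "nat \<Rightarrow> nat" and \<psi> :: "nat \<Rightarrow> nat \<Rightarrow> real"
  assumes start: "\<tau> 0 = 0" and step: "\<And>k. \<tau> k < \<tau> (Suc k)"
    and lip: "\<And>t s s'. s \<le> s' \<Longrightarrow> \<bar>\<psi> t s - \<psi> t s'\<bar> \<le> c * real (s' - s)"
    and bnd: "\<And>t. \<bar>\<psi> t T\<bar> \<le> b" and "c \<ge> 0"
  shows "\<bar>(\<Sum>t<T. \<psi> t t) -
      (\<Sum>k<T. if \<tau> k < T then \<Sum>i<\<tau> (Suc k) - \<tau> k. \<psi> (\<tau> k + i) (\<tau> k) else 0)\<bar>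
    \<le> (\<Sum>k<T. if \<tau> k < T then c * (real (\<tau> (Suc k) - \<tau> k))\<^sup>2 + b * real (\<tau> (Suc k) - T) else 0)"
    (is "\<bar>_ - (\<Sum>k<T. ?frozen k)\<bar> \<le> (\<Sum>k<T. ?err k)")
proof -
  let ?live = "\<lambda>k. \<Sum>i<\<tau> (Suc k) - \<tau> k. if \<tau> k + i < T then \<psi> (\<tau> k + i) (\<tau> k + i) else 0"
  have frame: "\<bar>?live k - ?frozen k\<bar> \<le> ?err k" for k
  proof (cases "\<tau> k < T")
    case False
    then show ?thesis by simp
  next
    case True
    let ?n = "\<tau> (Suc k) - \<tau> k"
    have slot: "\<bar>(if \<tau> k + i < T then \<psi> (\<tau> k + i) (\<tau> k + i) else 0) - \<psi> (\<tau> k + i) (\<tau> k)\<bar>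
        \<le> c * real ?n + (if \<tau> k + i < T then 0 else b)" if "i < ?n" for i
    proof (cases "\<tau> k + i < T")
      case True
      have "\<bar>\<psi> (\<tau> k + i) (\<tau> k) - \<psi> (\<tau> k + i) (\<tau> k + i)\<bar> \<le> c * real i"
        using lip[of "\<tau> k" "\<tau> k + i" "\<tau> k + i"] by simp
      also have "\<dots> \<le> c * real ?n" using that \<open>c \<ge> 0\<close> by (intro mult_left_mono) auto
      finally show ?thesis using True by (simp add: abs_minus_commute)
    next
      case False
      have "\<bar>\<psi> (\<tau> k + i) (\<tau> k) - \<psi> (\<tau> k + i) T\<bar> \<le> c * real (T - \<tau> k)"
        using lip[of "\<tau> k" T "\<tau> k + i"] \<open>\<tau> k < T\<close> by simp
      also have "\<dots> \<le> c * real ?n" using that False \<open>c \<ge> 0\<close> by (intro mult_left_mono) auto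
      finally show ?thesis using False bnd[of "\<tau> k + i"] by auto
    qed
    have "\<bar>?live k - ?frozen k\<bar> \<le> (\<Sum>i<?n. c * real ?n + (if \<tau> k + i < T then 0 else b))"
      using True slot by (auto simp flip: sum_subtractf intro!: order_trans[OF sum_abs] sum_mono)
    also have "\<dots> = c * (real ?n)\<^sup>2 + b * real (card {i. i < ?n \<and> \<not> \<tau> k + i < T})"
      using step[of k] by (simp add: sum.distrib power2_eq_square sum.If_cases Int_def of_nat_diff)
    also have "{i. i < ?n \<and> \<not> \<tau> k + i < T} = {T - \<tau> k..<?n}" using True by auto
    also have "card {T - \<tau> k..<?n} = \<tau> (Suc k) - T" using True by simp
    finally show ?thesis using True by (simp only: if_True)
  qed
  have "\<bar>(\<Sum>t<T. \<psi> t t) - (\<Sum>k<T. ?frozen k)\<bar> = \<bar>\<Sum>k<T. ?live k - ?frozen k\<bar>"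
    using sum_slots_eq_sum_frames[OF start step, of "\<lambda>t. \<psi> t t" T] by (simp add: sum_subtractf)
  also have "\<dots> \<le> (\<Sum>k<T. \<bar>?live k - ?frozen k\<bar>)" by (rule sum_abs)
  also have "\<dots> \<le> (\<Sum>k<T. ?err k)" by (intro sum_mono frame)
  finally show ?thesis .
qed

lemma at_most_one_straddling_frame:
  fixes \<tau> :: "nat \<Rightarrow> nat"
  assumes step: "\<And>k. \<tau> k < \<tau> (Suc k)"
  shows "card {k \<in> X. \<tau> k < T \<and> T \<le> \<tau> (Suc k)} \<le> 1"
proof -
  have mono: "\<tau> (Suc i) \<le> \<tau> j" if "i < j" for i j
    using lift_Suc_mono_le[of \<tau>, OF less_imp_le[OF step], of "Suc i" j] that by simp
  have "i = j" if "\<tau> i < T" "T \<le> \<tau> (Suc i)" "\<tau> j < T" "T \<le> \<tau> (Suc j)" for i j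
    using that mono[of i j] mono[of j i] by (cases i j rule: linorder_cases) auto
  then show ?thesis
    by (cases "finite {k \<in> X. \<tau> k < T \<and> T \<le> \<tau> (Suc k)}") (auto simp: card_le_Suc0_iff_eq)
qed

text \<open>
  Only the frame in progress at time \<open>T\<close> contributes to the sum, so squaring commutes with summation.
\<close>
lemma overshoot_squared:
  fixes \<tau> :: "nat \<Rightarrow> nat"
  assumes step: "\<And>k. \<tau> k < \<tau> (Suc k)"
  shows "(\<Sum>k<T. if \<tau> k < T then real (\<tau> (Suc k) - T) else 0)\<^sup>2 =
    (\<Sum>k<T. if \<tau> k < T then (real (\<tau> (Suc k) - T))\<^sup>2 else 0)"
proof -
  let ?S = "{k \<in> {..<T}. \<tau> k < T \<and> T \<le> \<tau> (Suc k)}"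
  have red: "(\<Sum>k<T. if \<tau> k < T then f (real (\<tau> (Suc k) - T)) else 0) =
      (\<Sum>k\<in>?S. f (real (\<tau> (Suc k) - T)))" if "f 0 = 0" for f :: "real \<Rightarrow> real"
    using that by (intro sum.mono_neutral_cong_right) (auto, metis diff_is_0_eq' nle_le of_nat_0)
  have "card ?S \<le> 1" using step by (rule at_most_one_straddling_frame)
  then consider "?S = {}" | k where "?S = {k}"
    by (metis (no_types, lifting) One_nat_def card_1_singletonE card_gt_0_iff finite_lessThan
        finite_subset le_antisym mem_Collect_eq subsetI Suc_leI)
  then show ?thesis
    unfolding red[of "\<lambda>x. x", OF refl] red[of "\<lambda>x. x\<^sup>2", OF power_zero_numeral] by cases (simp_all only:, simp_all)
qed

section \<open>The law of a single frame\<close>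

abbreviation frame_sum :: "(real \<times> (real ^ 'l::finite) \<Rightarrow> real) \<Rightarrow> 'l frame \<Rightarrow> real" where
  "frame_sum g x \<equiv> \<Sum>i<fst x. g (snd x i)"

lemma measurable_frame_length [measurable]: "fst \<in> frame_space \<rightarrow>\<^sub>M count_space UNIV"
  unfolding frame_space_def by measurable

lemma measurable_frame_slot [measurable]: "(\<lambda>x. snd x i) \<in> borel_measurable frame_space"
  unfolding frame_space_def by measurable

lemma measurable_frame_sum [measurable]:
  assumes [measurable]: "g \<in> borel_measurable borel"
  shows "frame_sum g \<in> borel_measurable frame_space"
proof -
  have "(\<lambda>x. \<Sum>i<m. g (snd x i)) \<in> borel_measurable frame_space" for m by measurable
  then show ?thesis by (rule measurable_compose_countable) simp
qed

lemma measurable_frame_metric_sum [measurable]: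
  "(\<lambda>x. \<Sum>i<fst x. snd (snd x i)) \<in> borel_measurable (frame_space :: 'l::finite frame measure)"
proof -
  have [measurable]: "(snd :: real \<times> (real ^ 'l) \<Rightarrow> _) \<in> borel_measurable borel"
    by (intro borel_measurable_continuous_onI continuous_intros)
  have "(\<lambda>x :: 'l frame. \<Sum>i<m. snd (snd x i)) \<in> borel_measurable frame_space" for m by measurable
  then show ?thesis by (rule measurable_compose_countable) simp
qed

locale bounded_renewal_systems = renewal_systems A K D
  for A :: "'n::finite \<Rightarrow> 'a measure"
    and K :: "'n \<Rightarrow> nat \<Rightarrow> 'a \<Rightarrow> 'l::finite frame measure"
    and D :: "(real ^ 'l) measure" +
  fixes ymax zmax dmax B :: real
  assumes bounded: "bounded_systems A K D ymax zmax dmax B"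
    and actions_nonempty: "space (A n) \<noteq> {}"
begin

lemma B_ge_1: "1 \<le> B"
  using bounded by (simp add: bounded_systems_def)

lemma
  assumes "a \<in> space (A n)"
  shows prob_space_kernel: "prob_space (K n k a)"
    and sets_kernel [measurable_cong]: "sets (K n k a) = sets frame_space"
  using measurable_space[OF kernel assms, of k] by (auto simp: space_prob_algebra)

lemma
  assumes "a \<in> space (A n)"
  shows AE_frame_penalty: "AE x in K n k a. \<forall>i<fst x. \<bar>fst (snd x i)\<bar> \<le> ymax"
    and AE_frame_metric: "AE x in K n k a. \<forall>i<fst x. \<forall>l. \<bar>snd (snd x i) $ l\<bar> \<le> zmax"
    and AE_frame_length: "AE x in K n k a. 1 \<le> fst x"
  using assms bounded frame_wf[OF assms, of k] unfolding bounded_systems_def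
  by (auto elim!: allE[of _ n] allE[of _ k] ballE[of _ _ a] elim: eventually_mono)

text \<open>
  The residual life bound without division by the probability of \<open>T \<ge> r\<close>; truncated subtraction
  makes the integrand vanish on the complementary event. In this form it can be summed over starting times.
\<close>
lemma residual_life:
  assumes a: "a \<in> space (A n)"
  shows "(\<integral>\<^sup>+x. ennreal ((real (fst x - r))\<^sup>2) \<partial>K n k a) \<le>
    ennreal B * emeasure (K n k a) {x \<in> space frame_space. fst x \<ge> r}"
proof -
  interpret P: prob_space "K n k a" using prob_space_kernel[OF a] .
  have [measurable_cong]: "sets (K n k a) = sets frame_space" by (rule sets_kernel[OF a])
  have sp: "space (K n k a) = space frame_space" by (rule sets_eq_imp_space_eq) fact
  let ?S = "{x \<in> space (K n k a). fst x \<ge> r}"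
  have S[measurable]: "?S \<in> sets (K n k a)" by measurable
  have eq: "(\<integral>\<^sup>+x. ennreal ((real (fst x - r))\<^sup>2) \<partial>K n k a) =
      (\<integral>\<^sup>+x. ennreal ((real (fst x) - real r)\<^sup>2) * indicator ?S x \<partial>K n k a)"
    by (intro nn_integral_cong) (auto simp: indicator_def of_nat_diff)
  show ?thesis
  proof (cases "P.prob ?S > 0")
    case True
    then have e0: "emeasure (K n k a) ?S \<noteq> 0" by (simp add: P.emeasure_eq_measure)
    have einf: "emeasure (K n k a) ?S \<noteq> \<top>" by simp
    have "(\<integral>\<^sup>+x. ennreal ((real (fst x) - real r)\<^sup>2) * indicator ?S x \<partial>K n k a) /
        emeasure (K n k a) ?S =
        (\<integral>\<^sup>+x. ennreal ((real (fst x) - real r)\<^sup>2) \<partial>uniform_measure (K n k a) ?S)"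
      by (rule nn_integral_uniform_measure[symmetric]) measurable
    also have "\<dots> \<le> ennreal B"
      using bounded a True unfolding bounded_systems_def by blast
    finally have "(\<integral>\<^sup>+x. ennreal ((real (fst x) - real r)\<^sup>2) * indicator ?S x \<partial>K n k a) /
        emeasure (K n k a) ?S * emeasure (K n k a) ?S \<le> ennreal B * emeasure (K n k a) ?S"
      by (rule mult_right_mono) simp
    moreover have "u / emeasure (K n k a) ?S * emeasure (K n k a) ?S = u" for u
      using ennreal_mult_divide_eq[OF e0 einf, of u] by (simp add: ennreal_times_divide mult.commute)
    ultimately show ?thesis unfolding eq sp[symmetric] by simp
  next
    case False
    then have "emeasure (K n k a) ?S = 0"
      by (simp add: P.emeasure_eq_measure order_antisym)
    then have "?S \<in> null_sets (K n k a)" using S by blast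
    then have "(\<integral>\<^sup>+x. ennreal ((real (fst x) - real r)\<^sup>2) * indicator ?S x \<partial>K n k a) = 0"
      by (rule nn_integral_null_set)
    then show ?thesis unfolding eq by simp
  qed
qed

lemma second_moment:
  assumes a: "a \<in> space (A n)"
  shows "(\<integral>\<^sup>+x. ennreal ((real (fst x))\<^sup>2) \<partial>K n k a) \<le> ennreal B"
proof -
  interpret P: prob_space "K n k a" using prob_space_kernel[OF a] .
  have "(\<integral>\<^sup>+x. ennreal ((real (fst x))\<^sup>2) \<partial>K n k a) \<le>
      ennreal B * emeasure (K n k a) {x \<in> space frame_space. fst x \<ge> 0}"
    using residual_life[OF a, where r = 0 and k = k] by simp
  also have "\<dots> \<le> ennreal B * 1" by (intro mult_left_mono P.emeasure_le_1) simp
  finally show ?thesis by simp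
qed

lemma first_moment:
  assumes a: "a \<in> space (A n)"
  shows "(\<integral>\<^sup>+x. ennreal (real (fst x)) \<partial>K n k a) \<le> ennreal B"
proof -
  have "real j \<le> (real j)\<^sup>2" for j by (metis le_square of_nat_le_iff of_nat_mult power2_eq_square)
  then have "(\<integral>\<^sup>+x. ennreal (real (fst x)) \<partial>K n k a) \<le> (\<integral>\<^sup>+x. ennreal ((real (fst x))\<^sup>2) \<partial>K n k a)"
    by (intro nn_integral_mono ennreal_leI)
  with second_moment[OF a, where k = k] show ?thesis by simp
qed

lemma integrable_linear_growth:
  fixes h :: "_ \<Rightarrow> 'c::{banach, second_countable_topology}"
  assumes a: "a \<in> space (A n)" and h [measurable]: "h \<in> borel_measurable frame_space"
    and bnd: "AE x in K n k a. norm (h x) \<le> C * real (fst x)"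
  shows "integrable (K n k a) h"
proof -
  have [measurable_cong]: "sets (K n k a) = sets frame_space" by (rule sets_kernel[OF a])
  have "integrable (K n k a) (\<lambda>x. real (fst x))"
    using first_moment[OF a, where k = k] by (intro integrableI_bounded) (auto simp: le_less_trans)
  then have "integrable (K n k a) (\<lambda>x. C * real (fst x))" by simp
  then show ?thesis by (rule Bochner_Integration.integrable_bound) (use bnd in \<open>auto elim: eventually_mono\<close>)
qed

lemma AE_frame_sum_bound:
  assumes "AE x in K n k a. \<forall>i<fst x. \<bar>g (snd x i)\<bar> \<le> C"
  shows "AE x in K n k a. \<bar>frame_sum g x\<bar> \<le> C * real (fst x)"
  using assms
proof eventually_elim
  case (elim x)
  have "\<bar>frame_sum g x\<bar> \<le> (\<Sum>i<fst x. C)" using elim by (intro order_trans[OF sum_abs] sum_mono) auto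
  then show ?case by (simp add: mult.commute)
qed

lemma mean_length_ge_1:
  assumes a: "a \<in> space (A n)"
  shows "1 \<le> mean_length (K n k) a"
proof -
  interpret P: prob_space "K n k a" using prob_space_kernel[OF a] .
  have "integrable (K n k a) (\<lambda>x. real (fst x))"
    by (rule integrable_linear_growth[OF a, where C = 1]) auto
  then have "(\<integral>x. 1 \<partial>K n k a) \<le> (\<integral>x. real (fst x) \<partial>K n k a)"
    using AE_frame_length[OF a, of k] by (intro integral_mono_AE) auto
  then show ?thesis by (simp add: mean_length_def P.prob_space)
qed

lemma abs_integral_frame_sum:
  assumes a: "a \<in> space (A n)" and [measurable]: "g \<in> borel_measurable borel"
    and "AE x in K n k a. \<forall>i<fst x. \<bar>g (snd x i)\<bar> \<le> C"
  shows "integrable (K n k a) (frame_sum g)"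
    and "\<bar>\<integral>x. frame_sum g x \<partial>K n k a\<bar> \<le> C * mean_length (K n k) a"
proof -
  have bnd: "AE x in K n k a. norm (frame_sum g x) \<le> C * real (fst x)"
    unfolding real_norm_def using assms(3) by (rule AE_frame_sum_bound)
  show int: "integrable (K n k a) (frame_sum g)"
    by (rule integrable_linear_growth[OF a _ bnd]) measurable
  have "integrable (K n k a) (\<lambda>x. real (fst x))"
    by (rule integrable_linear_growth[OF a, where C = 1]) auto
  then have "\<bar>\<integral>x. frame_sum g x \<partial>K n k a\<bar> \<le> (\<integral>x. C * real (fst x) \<partial>K n k a)"
    using int bnd by (intro order_trans[OF integral_abs_bound] integral_mono_AE) auto
  then show "\<bar>\<integral>x. frame_sum g x \<partial>K n k a\<bar> \<le> C * mean_length (K n k) a"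
    by (simp add: mean_length_def)
qed

lemma measurable_penalty_component [measurable]: "(fst :: real \<times> (real ^ 'l) \<Rightarrow> real) \<in> borel_measurable borel"
  by (intro borel_measurable_continuous_onI continuous_intros)

lemma measurable_metric_component [measurable]:
  "(\<lambda>p :: real \<times> (real ^ 'l). snd p $ l) \<in> borel_measurable borel"
  by (intro borel_measurable_continuous_onI continuous_intros)

lemma mean_metric_component:
  assumes a: "a \<in> space (A n)"
  shows "mean_metric (K n k) a $ l = (\<integral>x. frame_sum (\<lambda>p. snd p $ l) x \<partial>K n k a)"
proof -
  have slot: "norm v \<le> real CARD('l) * zmax" if "\<And>l. \<bar>v $ l\<bar> \<le> zmax" for v :: "real ^ 'l"
    using that by (intro order_trans[OF norm_le_l1_cart] order_trans[OF sum_bounded_above[of _ _ zmax]]) auto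
  have "AE x in K n k a. norm (\<Sum>i<fst x. snd (snd x i)) \<le> (real CARD('l) * zmax) * real (fst x)"
    using AE_frame_metric[OF a, of k]
  proof eventually_elim
    case (elim x)
    have "norm (\<Sum>i<fst x. snd (snd x i)) \<le> (\<Sum>i<fst x. real CARD('l) * zmax)"
      using elim by (intro order_trans[OF norm_sum] sum_mono slot) auto
    then show ?case by (simp add: mult.commute)
  qed
  then have "integrable (K n k a) (\<lambda>x. \<Sum>i<fst x. snd (snd x i))"
    by (intro integrable_linear_growth[OF a]) measurable
  then show ?thesis
    unfolding mean_metric_def
    by (subst integral_bounded_linear[OF bounded_linear_vec_nth, symmetric]) simp_all
qed

lemma penalty_rate_bound:
  assumes a: "a \<in> space (A n)"
  shows "\<bar>penalty_rate (K n k) a\<bar> \<le> ymax"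
  using abs_integral_frame_sum(2)[OF a _ AE_frame_penalty[OF a, of k]] mean_length_ge_1[OF a, of k]
  by (simp add: penalty_rate_def mean_penalty_def abs_divide divide_simps)

lemma metric_rate_bound:
  assumes a: "a \<in> space (A n)"
  shows "\<bar>metric_rate (K n k) a $ l\<bar> \<le> zmax"
proof -
  have "\<bar>mean_metric (K n k) a $ l\<bar> \<le> zmax * mean_length (K n k) a"
    unfolding mean_metric_component[OF a]
    using AE_frame_metric[OF a, of k] by (intro abs_integral_frame_sum(2)[OF a]) (auto elim: eventually_mono)
  then show ?thesis
    using mean_length_ge_1[OF a, of k] by (simp add: metric_rate_def abs_mult divide_simps)
qed

end

section \<open>Frames of a decision sequence\<close>

locale bounded_decision_sequence = decision_sequence A K D M F \<tau> \<alpha> y z d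
  for A :: "'n::finite \<Rightarrow> 'a measure"
    and K :: "'n \<Rightarrow> nat \<Rightarrow> 'a \<Rightarrow> 'l::finite frame measure"
    and D :: "(real ^ 'l) measure"
    and M :: "'w measure"
    and F :: "nat \<Rightarrow> 'w measure"
    and \<tau> :: "'n \<Rightarrow> nat \<Rightarrow> 'w \<Rightarrow> nat"
    and \<alpha> :: "'n \<Rightarrow> nat \<Rightarrow> 'w \<Rightarrow> 'a"
    and y :: "'n \<Rightarrow> nat \<Rightarrow> 'w \<Rightarrow> real"
    and z :: "'n \<Rightarrow> nat \<Rightarrow> 'w \<Rightarrow> real ^ 'l"
    and d :: "nat \<Rightarrow> 'w \<Rightarrow> real ^ 'l" +
  fixes ymax zmax dmax B :: real
  assumes run_bounded: "bounded_systems A K D ymax zmax dmax B"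

sublocale bounded_decision_sequence \<subseteq> bounded_renewal_systems A K D ymax zmax dmax B
proof
  show "space (A n) \<noteq> {}" for n using action_mem not_empty by blast
qed (rule run_bounded)

context bounded_decision_sequence
begin

abbreviation starts :: "'n \<Rightarrow> nat \<Rightarrow> nat \<Rightarrow> 'w set" where
  "starts n k s \<equiv> {\<omega> \<in> space M. \<tau> n k \<omega> = s}"

abbreviation outcome :: "'n \<Rightarrow> nat \<Rightarrow> 'w \<Rightarrow> 'l frame" where
  "outcome \<equiv> frame_outcome \<tau> y z"

lemma starts_in_F: "starts n k s \<in> sets (F s)"
proof -
  have "starts n k s = {\<omega> \<in> space M. \<tau> n k \<omega> = s \<and> \<alpha> n k \<omega> \<in> space (A n)}"
    using action_mem by auto
  then show ?thesis using action_adapted[OF sets.top] by simp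
qed

lemma F_in_M: "E \<in> sets (F s) \<Longrightarrow> E \<in> sets M"
  using subalgebra unfolding subalgebra_def by blast

lemma measurable_F_M: "f \<in> borel_measurable (F s) \<Longrightarrow> f \<in> borel_measurable M"
  using measurable_from_subalg[OF subalgebra] .

lemma starts_in_M [measurable]: "starts n k s \<in> sets M"
  using starts_in_F F_in_M by blast

lemma measurable_renewal_time [measurable]: "\<tau> n k \<in> M \<rightarrow>\<^sub>M count_space UNIV"
proof (rule measurableI)
  fix X :: "nat set"
  have "\<tau> n k -` X \<inter> space M = (\<Union>s\<in>X. starts n k s)" by auto
  also have "\<dots> \<in> sets M" by (intro sets.countable_UN'') auto
  finally show "\<tau> n k -` X \<inter> space M \<in> sets M" .
qed simp

lemma measurable_action [measurable]: "\<alpha> n k \<in> M \<rightarrow>\<^sub>M A n"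
proof (rule measurableI)
  fix U assume U: "U \<in> sets (A n)"
  have "\<alpha> n k -` U \<inter> space M = (\<Union>s. {\<omega> \<in> space M. \<tau> n k \<omega> = s \<and> \<alpha> n k \<omega> \<in> U})" by auto
  also have "\<dots> \<in> sets M" using action_adapted[OF U] F_in_M by (intro sets.countable_UN) blast
  finally show "\<alpha> n k -` U \<inter> space M \<in> sets M" .
qed (rule action_mem)

lemma measurable_penalty [measurable]: "y n t \<in> borel_measurable M"
  using measurable_F_M[OF penalty_adapted] .

lemma measurable_metric [measurable]: "z n t \<in> borel_measurable M"
  using measurable_F_M[OF metric_adapted] .

lemma measurable_external [measurable]: "d t \<in> borel_measurable M"
  using measurable_F_M[OF external_adapted] .

lemma measurable_at_frame_slot:
  fixes f :: "nat \<Rightarrow> 'w \<Rightarrow> 'b::topological_space"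
  assumes [measurable]: "\<And>t. f t \<in> borel_measurable M"
  shows "(\<lambda>\<omega>. f (\<tau> n k \<omega> + i) \<omega>) \<in> borel_measurable M"
proof -
  have "(\<lambda>\<omega>. f (s + i) \<omega>) \<in> borel_measurable M" for s by measurable
  then show ?thesis by (rule measurable_compose_countable) measurable
qed

lemma measurable_outcome [measurable]: "outcome n k \<in> M \<rightarrow>\<^sub>M frame_space"
proof -
  note measurable_at_frame_slot[OF measurable_penalty, measurable]
    measurable_at_frame_slot[OF measurable_metric, measurable]
  have [measurable]: "(\<lambda>\<omega>. if i < \<tau> n (Suc k) \<omega> - \<tau> n k \<omega>
      then (y n (\<tau> n k \<omega> + i) \<omega>, z n (\<tau> n k \<omega> + i) \<omega>) else 0) \<in> borel_measurable M" for i
  proof -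
    have [measurable]: "(\<lambda>\<omega>. (y n (\<tau> n k \<omega> + i) \<omega>, z n (\<tau> n k \<omega> + i) \<omega>)) \<in> borel_measurable M"
      by (intro borel_measurable_Pair) measurable
    have "{\<omega> \<in> space M. i < \<tau> n (Suc k) \<omega> - \<tau> n k \<omega>} =
        (\<Union>s. \<Union>t. if i < t - s then {\<omega> \<in> space M. \<tau> n (Suc k) \<omega> = t \<and> \<tau> n k \<omega> = s} else {})"
      by auto
    also have "\<dots> \<in> sets M"
    proof (intro sets.countable_UN'')
      fix s t
      have "{\<omega> \<in> space M. \<tau> n (Suc k) \<omega> = t \<and> \<tau> n k \<omega> = s} \<in> sets M" by measurable
      then show "(if i < t - s then {\<omega> \<in> space M. \<tau> n (Suc k) \<omega> = t \<and> \<tau> n k \<omega> = s} else {}) \<in> sets M"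
        by simp
    qed auto
    finally have [measurable]: "{\<omega> \<in> space M. i < \<tau> n (Suc k) \<omega> - \<tau> n k \<omega>} \<in> sets M" .
    show ?thesis by measurable
  qed
  show ?thesis
    unfolding frame_outcome_def[abs_def] frame_space_def
    by (intro measurable_Pair measurable_abs_UNIV) measurable
qed

lemma measurable_kernel_action: "(\<lambda>\<omega>. K n k (\<alpha> n k \<omega>)) \<in> M \<rightarrow>\<^sub>M subprob_algebra frame_space"
  using measurable_prob_algebraD[OF kernel] by measurable

text \<open>
  The renewal property says that, on an event \<open>E\<close> of the past on which frame \<open>k\<close> starts in slot \<open>s\<close>, the law
  of the outcome is the mixture of the kernels over the chosen actions. As an equality of measures
  it extends from indicators to all nonnegative functions of the outcome.
\<close>
lemma nn_integral_frame:
  assumes E: "E \<in> sets (F s)" "E \<subseteq> starts n k s"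
    and h [measurable]: "h \<in> borel_measurable frame_space"
  shows "(\<integral>\<^sup>+\<omega>\<in>E. h (outcome n k \<omega>) \<partial>M) = (\<integral>\<^sup>+\<omega>\<in>E. (\<integral>\<^sup>+x. h x \<partial>K n k (\<alpha> n k \<omega>)) \<partial>M)"
proof -
  have [measurable]: "E \<in> sets M" using E(1) by (rule F_in_M)
  let ?N = "density M (indicator E)"
  have Nker: "(\<lambda>\<omega>. K n k (\<alpha> n k \<omega>)) \<in> ?N \<rightarrow>\<^sub>M subprob_algebra frame_space"
    using measurable_kernel_action by simp
  note measurable_kernel_action[of n k, measurable]
  \<comment> \<open>Restricting \<open>M\<close> to \<open>E\<close> by a density turns the renewal property into an identity of measures.\<close>
  have law: "distr ?N frame_space (outcome n k) = ?N \<bind> (\<lambda>\<omega>. K n k (\<alpha> n k \<omega>))"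
  proof (rule measure_eqI)
    show "sets (distr ?N frame_space (outcome n k)) = sets (?N \<bind> (\<lambda>\<omega>. K n k (\<alpha> n k \<omega>)))"
      using not_empty sets_kernel[OF action_mem] by (subst sets_bind[of _ _ frame_space]) auto
  next
    fix S assume "S \<in> sets (distr ?N frame_space (outcome n k))"
    then have S [measurable]: "S \<in> sets frame_space" by simp
    have "emeasure (distr ?N frame_space (outcome n k)) S =
        emeasure ?N (outcome n k -` S \<inter> space M)"
      by (subst emeasure_distr) auto
    also have "\<dots> = emeasure M (E \<inter> (outcome n k -` S \<inter> space M))"
      by (subst emeasure_density) (auto simp flip: indicator_inter_arith)
    also have "E \<inter> (outcome n k -` S \<inter> space M) = {\<omega> \<in> E. outcome n k \<omega> \<in> S}"
      using E(2) by auto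
    also have "emeasure M \<dots> = (\<integral>\<^sup>+\<omega>\<in>E. emeasure (K n k (\<alpha> n k \<omega>)) S \<partial>M)"
      by (rule renewal[OF E S])
    also have "\<dots> = emeasure (?N \<bind> (\<lambda>\<omega>. K n k (\<alpha> n k \<omega>))) S"
      using not_empty
      by (subst emeasure_bind[OF _ Nker S]) (auto simp: nn_integral_density mult.commute)
    finally show "emeasure (distr ?N frame_space (outcome n k)) S =
        emeasure (?N \<bind> (\<lambda>\<omega>. K n k (\<alpha> n k \<omega>))) S" .
  qed
  have "(\<integral>\<^sup>+\<omega>\<in>E. h (outcome n k \<omega>) \<partial>M) = (\<integral>\<^sup>+x. h x \<partial>distr ?N frame_space (outcome n k))"
    by (subst nn_integral_distr) (auto simp: nn_integral_density mult.commute)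
  also have "\<dots> = (\<integral>\<^sup>+\<omega>. \<integral>\<^sup>+x. h x \<partial>K n k (\<alpha> n k \<omega>) \<partial>?N)"
    unfolding law by (rule nn_integral_bind[OF h Nker])
  also have "\<dots> = (\<integral>\<^sup>+\<omega>\<in>E. (\<integral>\<^sup>+x. h x \<partial>K n k (\<alpha> n k \<omega>)) \<partial>M)"
    by (subst nn_integral_density)
      (auto simp: mult.commute intro!: nn_integral_measurable_subprob_algebra2[of _ _ frame_space])
  finally show ?thesis .
qed

lemma AE_outcome:
  assumes [measurable]: "Measurable.pred frame_space P"
    and P: "\<And>a. a \<in> space (A n) \<Longrightarrow> AE x in K n k a. P x"
  shows "AE \<omega> in M. P (outcome n k \<omega>)"
proof -
  have on_start: "AE \<omega> in M. \<omega> \<in> starts n k s \<longrightarrow> P (outcome n k \<omega>)" for s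
  proof -
    let ?h = "indicator {x \<in> space frame_space. \<not> P x} :: _ \<Rightarrow> ennreal"
    have sp: "outcome n k \<omega> \<in> space frame_space" if "\<omega> \<in> space M" for \<omega>
      using measurable_space[OF measurable_outcome that] .
    have "(\<integral>\<^sup>+\<omega>\<in>starts n k s. ?h (outcome n k \<omega>) \<partial>M) =
        (\<integral>\<^sup>+\<omega>\<in>starts n k s. (\<integral>\<^sup>+x. ?h x \<partial>K n k (\<alpha> n k \<omega>)) \<partial>M)"
      by (rule nn_integral_frame[OF starts_in_F]) auto
    also have "\<dots> = (\<integral>\<^sup>+\<omega>\<in>starts n k s. 0 \<partial>M)"
    proof (intro nn_integral_cong arg_cong2[where f = "(*)"] refl)
      fix \<omega> assume "\<omega> \<in> space M"
      then have a: "\<alpha> n k \<omega> \<in> space (A n)" by (rule action_mem)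
      have "(\<integral>\<^sup>+x. ?h x \<partial>K n k (\<alpha> n k \<omega>)) = (\<integral>\<^sup>+x. 0 \<partial>K n k (\<alpha> n k \<omega>))"
        using P[OF a] by (intro nn_integral_cong_AE) (auto elim: eventually_mono)
      then show "(\<integral>\<^sup>+x. ?h x \<partial>K n k (\<alpha> n k \<omega>)) = 0" by simp
    qed
    finally have "(\<integral>\<^sup>+\<omega>\<in>starts n k s. ?h (outcome n k \<omega>) \<partial>M) = 0" by simp
    then have "AE \<omega> in M. ?h (outcome n k \<omega>) * indicator (starts n k s) \<omega> = 0"
      by (subst (asm) nn_integral_0_iff_AE) auto
    then show ?thesis using AE_space
      by eventually_elim (auto simp: sp split: split_indicator_asm)
  qed
  have "AE \<omega> in M. \<forall>s. \<omega> \<in> starts n k s \<longrightarrow> P (outcome n k \<omega>)"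
    unfolding AE_all_countable by (rule allI) (rule on_start)
  then show ?thesis using AE_space by eventually_elim auto
qed

lemma
  assumes [measurable]: "h \<in> borel_measurable frame_space"
    and nonneg: "\<And>x. 0 \<le> h x"
    and C: "\<And>a. a \<in> space (A n) \<Longrightarrow> AE x in K n k a. \<bar>h x :: real\<bar> \<le> C * real (fst x)"
  shows integrable_frame_nonneg:
      "integrable M (\<lambda>\<omega>. indicator (starts n k s) \<omega> * h (outcome n k \<omega>))"
      "integrable M (\<lambda>\<omega>. indicator (starts n k s) \<omega> * (\<integral>x. h x \<partial>K n k (\<alpha> n k \<omega>)))"
    and set_integral_frame_nonneg: "E \<in> sets (F s) \<Longrightarrow>
      (\<integral>\<omega>\<in>E. indicator (starts n k s) \<omega> * h (outcome n k \<omega>) \<partial>M) =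
      (\<integral>\<omega>\<in>E. indicator (starts n k s) \<omega> * (\<integral>x. h x \<partial>K n k (\<alpha> n k \<omega>)) \<partial>M)"
proof -
  let ?H = "\<lambda>\<omega>. \<integral>x. h x \<partial>K n k (\<alpha> n k \<omega>)"
  have nn: "(\<integral>\<^sup>+x. ennreal (h x) \<partial>K n k a) = ennreal (\<integral>x. h x \<partial>K n k a)" if "a \<in> space (A n)" for a
    using integrable_linear_growth[OF that _ C[OF that, folded real_norm_def]] nonneg
    by (intro nn_integral_eq_integral) auto
  note measurable_kernel_action[of n k, measurable]
  have [measurable]: "?H \<in> borel_measurable M"
    by (rule measurable_compose[OF measurable_kernel_action integral_measurable_subprob_algebra]) simp
  have eq: "(\<integral>\<^sup>+\<omega>\<in>E. ennreal (indicator (starts n k s) \<omega> * h (outcome n k \<omega>)) \<partial>M) =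
      (\<integral>\<^sup>+\<omega>\<in>E. ennreal (indicator (starts n k s) \<omega> * ?H \<omega>) \<partial>M)"
    if E: "E \<in> sets (F s)" for E
  proof -
    have "(\<integral>\<^sup>+\<omega>\<in>E. ennreal (indicator (starts n k s) \<omega> * h (outcome n k \<omega>)) \<partial>M) =
        (\<integral>\<^sup>+\<omega>\<in>E \<inter> starts n k s. ennreal (h (outcome n k \<omega>)) \<partial>M)"
      by (intro nn_integral_cong) (auto simp: indicator_def)
    also have "\<dots> = (\<integral>\<^sup>+\<omega>\<in>E \<inter> starts n k s. (\<integral>\<^sup>+x. ennreal (h x) \<partial>K n k (\<alpha> n k \<omega>)) \<partial>M)"
      using E starts_in_F by (intro nn_integral_frame[where s = s]) auto
    also have "\<dots> = (\<integral>\<^sup>+\<omega>\<in>E. ennreal (indicator (starts n k s) \<omega> * ?H \<omega>) \<partial>M)"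
      by (intro nn_integral_cong) (auto simp: indicator_def nn action_mem)
    finally show ?thesis .
  qed
  have H_bnd: "?H \<omega> \<le> \<bar>C\<bar> * B" if "\<omega> \<in> space M" for \<omega>
  proof -
    have a: "\<alpha> n k \<omega> \<in> space (A n)" using that by (rule action_mem)
    have len: "(\<lambda>x. ennreal (real (fst x))) \<in> borel_measurable (K n k (\<alpha> n k \<omega>))"
      unfolding measurable_cong_sets[OF sets_kernel[OF a] refl]
      by (intro measurable_compose[OF measurable_frame_length]) simp
    have "ennreal (?H \<omega>) \<le> (\<integral>\<^sup>+x. ennreal \<bar>C\<bar> * ennreal (real (fst x)) \<partial>K n k (\<alpha> n k \<omega>))"
      unfolding nn[OF a, symmetric] using C[OF a]
      by (intro nn_integral_mono_AE)
        (auto elim!: eventually_mono simp: ennreal_mult'[symmetric] nonneg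
          intro!: ennreal_leI order_trans[OF _ mult_right_mono[OF abs_ge_self]])
    also have "\<dots> = ennreal \<bar>C\<bar> * (\<integral>\<^sup>+x. ennreal (real (fst x)) \<partial>K n k (\<alpha> n k \<omega>))"
      by (intro nn_integral_cmult len)
    also have "\<dots> \<le> ennreal \<bar>C\<bar> * ennreal B"
      by (intro mult_left_mono first_moment[OF a]) simp
    finally show ?thesis using B_ge_1 by (simp add: ennreal_mult'[symmetric])
  qed
  show intH: "integrable M (\<lambda>\<omega>. indicator (starts n k s) \<omega> * ?H \<omega>)"
  proof (rule integrable_const_bound[where B = "\<bar>C\<bar> * B"])
    have "0 \<le> ?H \<omega>" for \<omega> using nonneg by (intro Bochner_Integration.integral_nonneg)
    then show "AE \<omega> in M. norm (indicator (starts n k s) \<omega> * ?H \<omega>) \<le> \<bar>C\<bar> * B"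
      using H_bnd B_ge_1 by (intro AE_I2) (auto split: split_indicator)
  qed measurable
  have top: "(\<integral>\<^sup>+\<omega>. ennreal (indicator (starts n k s) \<omega> * h (outcome n k \<omega>)) \<partial>M) < \<infinity>"
  proof -
    have "(\<integral>\<^sup>+\<omega>. ennreal (indicator (starts n k s) \<omega> * h (outcome n k \<omega>)) \<partial>M) =
        (\<integral>\<^sup>+\<omega>. ennreal (indicator (starts n k s) \<omega> * ?H \<omega>) \<partial>M)"
      using eq[of "space M"] sets.top[of "F s"] space_F[of s]
      by (simp add: indicator_def cong: nn_integral_cong)
    then show ?thesis using intH nonneg
      by (subst (asm) (2) nn_integral_eq_integral) (auto simp: less_top[symmetric])
  qed
  show int: "integrable M (\<lambda>\<omega>. indicator (starts n k s) \<omega> * h (outcome n k \<omega>))"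
    using top nonneg by (intro integrableI_bounded) auto
  assume E: "E \<in> sets (F s)"
  then have [measurable]: "E \<in> sets M" by (rule F_in_M)
  have conv: "(\<integral>\<omega>\<in>E. f \<omega> \<partial>M) = enn2real (\<integral>\<^sup>+\<omega>\<in>E. ennreal (f \<omega>) \<partial>M)"
    if [measurable]: "f \<in> borel_measurable M" and "\<And>\<omega>. 0 \<le> f \<omega>" for f :: "'w \<Rightarrow> real"
    unfolding set_lebesgue_integral_def using that
    by (subst integral_eq_nn_integral) (auto intro!: arg_cong[of _ _ enn2real] nn_integral_cong
        simp: indicator_def)
  show "(\<integral>\<omega>\<in>E. indicator (starts n k s) \<omega> * h (outcome n k \<omega>) \<partial>M) =
      (\<integral>\<omega>\<in>E. indicator (starts n k s) \<omega> * ?H \<omega> \<partial>M)"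
    using nonneg eq[OF E] by (subst (1 2) conv) auto
qed

text \<open>
  The renewal property as an orthogonality relation: the conditional expectation of \<open>h (outcome)\<close> given \<open>F s\<close>
  is the mean of \<open>h\<close> under the kernel of the chosen action, so a past-measurable weight \<open>w\<close> may be pulled
  out. The weights will be queue lengths. Linear growth of \<open>h\<close> in the frame length
  is the natural integrability condition for sums over the slots of a frame.
\<close>
lemma
  assumes [measurable]: "h \<in> borel_measurable frame_space"
    and C: "\<And>a. a \<in> space (A n) \<Longrightarrow> AE x in K n k a. \<bar>h x :: real\<bar> \<le> C * real (fst x)"
    and w: "w \<in> borel_measurable (F s)" and w_bnd: "AE \<omega> in M. \<bar>w \<omega>\<bar> \<le> c"
  shows integrable_weighted_frame:
      "integrable M (\<lambda>\<omega>. w \<omega> * (indicator (starts n k s) \<omega> * h (outcome n k \<omega>)))"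
      "integrable M (\<lambda>\<omega>. w \<omega> * (indicator (starts n k s) \<omega> * (\<integral>x. h x \<partial>K n k (\<alpha> n k \<omega>))))"
    and integral_weighted_frame:
      "(\<integral>\<omega>. w \<omega> * (indicator (starts n k s) \<omega> * h (outcome n k \<omega>)) \<partial>M) =
       (\<integral>\<omega>. w \<omega> * (indicator (starts n k s) \<omega> * (\<integral>x. h x \<partial>K n k (\<alpha> n k \<omega>))) \<partial>M)"
proof -
  interpret finite_measure_subalgebra M "F s"
    by unfold_locales (rule subalgebra)
  let ?I = "indicator (starts n k s) :: _ \<Rightarrow> real"
  let ?f = "\<lambda>\<omega>. ?I \<omega> * h (outcome n k \<omega>)"
  let ?g = "\<lambda>\<omega>. ?I \<omega> * (\<integral>x. h x \<partial>K n k (\<alpha> n k \<omega>))"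
  let ?p = "\<lambda>x. max (h x) 0" and ?m = "\<lambda>x. max (- h x) 0"
  have pC: "AE x in K n k a. \<bar>?p x\<bar> \<le> C * real (fst x)"
    and mC: "AE x in K n k a. \<bar>?m x\<bar> \<le> C * real (fst x)" if "a \<in> space (A n)" for a
    using C[OF that] by (auto elim!: eventually_mono simp: max_def)
  note P = integrable_frame_nonneg[of ?p, OF _ _ pC, where s = s]
    set_integral_frame_nonneg[of ?p, OF _ _ pC, where s = s]
  note N = integrable_frame_nonneg[of ?m, OF _ _ mC, where s = s]
    set_integral_frame_nonneg[of ?m, OF _ _ mC, where s = s]
  have f_eq: "?f = (\<lambda>\<omega>. ?I \<omega> * ?p (outcome n k \<omega>) - ?I \<omega> * ?m (outcome n k \<omega>))"
    by (auto simp: fun_eq_iff max_def indicator_def)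
  have "(\<integral>x. h x \<partial>K n k a) = (\<integral>x. ?p x \<partial>K n k a) - (\<integral>x. ?m x \<partial>K n k a)"
    if "a \<in> space (A n)" for a
  proof -
    have "(\<integral>x. h x \<partial>K n k a) = (\<integral>x. ?p x - ?m x \<partial>K n k a)"
      by (intro Bochner_Integration.integral_cong) (auto simp: max_def)
    also have "\<dots> = (\<integral>x. ?p x \<partial>K n k a) - (\<integral>x. ?m x \<partial>K n k a)"
      using that pC mC
      by (intro Bochner_Integration.integral_diff integrable_linear_growth[where C = C]) auto
    finally show ?thesis .
  qed
  then have g_eq: "?g \<omega> = ?I \<omega> * (\<integral>x. ?p x \<partial>K n k (\<alpha> n k \<omega>)) - ?I \<omega> * (\<integral>x. ?m x \<partial>K n k (\<alpha> n k \<omega>))"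
    for \<omega> using action_mem[of \<omega> n k] by (auto simp: indicator_def)
  have intf: "integrable M ?f"
    unfolding f_eq by (intro Bochner_Integration.integrable_diff P N) auto
  have intg: "integrable M ?g"
    unfolding g_eq by (intro Bochner_Integration.integrable_diff P N) auto
  have gF: "?g \<in> borel_measurable (F s)"
  proof -
    have meas: "(\<lambda>a. \<integral>x. h x \<partial>K n k a) \<in> borel_measurable (A n)"
      by (rule measurable_compose[OF measurable_prob_algebraD[OF kernel]
            integral_measurable_subprob_algebra]) simp
    show ?thesis
    proof (rule measurableI)
      fix S :: "real set" assume S: "S \<in> sets borel"
      let ?U = "(\<lambda>a. \<integral>x. h x \<partial>K n k a) -` S \<inter> space (A n)"
      have U: "?U \<in> sets (A n)" using meas S by (rule measurable_sets)
      have "?g -` S \<inter> space (F s) = {\<omega> \<in> space M. \<tau> n k \<omega> = s \<and> \<alpha> n k \<omega> \<in> ?U} \<union>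
          (if 0 \<in> S then space (F s) - starts n k s else {})"
        using action_mem by (auto simp: space_F split: split_indicator split_indicator_asm)
      also have "\<dots> \<in> sets (F s)" using action_adapted[OF U, of k s] starts_in_F[of n k s] by auto
      finally show "?g -` S \<inter> space (F s) \<in> sets (F s)" .
    qed simp
  qed
  have ce: "AE \<omega> in M. real_cond_exp M (F s) ?f \<omega> = ?g \<omega>"
  proof (rule real_cond_exp_charact[OF _ intf intg gF])
    fix E assume E: "E \<in> sets (F s)"
    then have EM: "E \<in> sets M" by (rule F_in_M)
    note si = integrable_mult_indicator[OF EM, unfolded set_integrable_def[symmetric]]
    show "(\<integral>\<omega>\<in>E. ?f \<omega> \<partial>M) = (\<integral>\<omega>\<in>E. ?g \<omega> \<partial>M)"
      unfolding f_eq g_eq using E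
      by (subst (1 2) set_integral_diff) (auto intro!: P N si arg_cong2[where f = "(-)"])
  qed
  have [measurable]: "w \<in> borel_measurable M" using w by (rule measurable_F_M)
  have wint: "integrable M (\<lambda>\<omega>. w \<omega> * u \<omega>)" if u: "integrable M u" for u :: "'w \<Rightarrow> real"
  proof (rule Bochner_Integration.integrable_bound)
    show "integrable M (\<lambda>\<omega>. c * \<bar>u \<omega>\<bar>)" using u by simp
    show "AE \<omega> in M. norm (w \<omega> * u \<omega>) \<le> norm (c * \<bar>u \<omega>\<bar>)"
      using w_bnd by eventually_elim (auto simp: abs_mult intro!: mult_right_mono)
  qed (use u in measurable)
  show "integrable M (\<lambda>\<omega>. w \<omega> * ?f \<omega>)" "integrable M (\<lambda>\<omega>. w \<omega> * ?g \<omega>)"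
    using intf intg by (auto intro: wint)
  have "(\<integral>\<omega>. w \<omega> * ?f \<omega> \<partial>M) = (\<integral>\<omega>. w \<omega> * real_cond_exp M (F s) ?f \<omega> \<partial>M)"
    using intf by (intro real_cond_exp_intg(2)[symmetric] wint w) auto
  also have "\<dots> = (\<integral>\<omega>. w \<omega> * ?g \<omega> \<partial>M)"
    using ce intg by (intro integral_cong_AE) (auto elim: eventually_mono)
  finally show "(\<integral>\<omega>. w \<omega> * ?f \<omega> \<partial>M) = (\<integral>\<omega>. w \<omega> * ?g \<omega> \<partial>M)" .
qed

end

section \<open>The minimal cost rate\<close>

text \<open>
  The quantity that the algorithm attains at \<open>q = Q[t]\<close>. As the minimum of a linear
  functional it is the same for the convex hull of the achievable rates, so in the long run no randomized or
  history-dependent policy beats it at prices \<open>q\<close>.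
\<close>
definition min_cost ::
  "real \<Rightarrow> ('n \<Rightarrow> 'a measure) \<Rightarrow> ('n \<Rightarrow> nat \<Rightarrow> 'a \<Rightarrow> 'l::finite frame measure) \<Rightarrow> 'n \<Rightarrow>
    real ^ 'l \<Rightarrow> real" where
  "min_cost V A K n q =
     (INF a\<in>space (A n). V * penalty_rate (K n 0) a + q \<bullet> metric_rate (K n 0) a)"

definition l1_norm :: "real ^ 'l::finite \<Rightarrow> real" where
  "l1_norm q = (\<Sum>l\<in>UNIV. \<bar>q $ l\<bar>)"

lemma abs_inner_le_l1_norm:
  fixes q :: "real ^ 'l::finite"
  assumes "\<And>l. \<bar>x $ l\<bar> \<le> c"
  shows "\<bar>q \<bullet> x\<bar> \<le> c * l1_norm q"
proof -
  have "\<bar>q \<bullet> x\<bar> \<le> (\<Sum>l\<in>UNIV. \<bar>q $ l * x $ l\<bar>)"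
    by (simp add: inner_vec_def sum_abs)
  also have "\<dots> \<le> (\<Sum>l\<in>UNIV. \<bar>q $ l\<bar> * c)"
    by (intro sum_mono) (simp add: abs_mult assms mult_left_mono)
  finally show ?thesis by (simp only: l1_norm_def sum_distrib_right mult.commute[of c])
qed

lemma l1_norm_nonneg: "0 \<le> l1_norm q" by (simp add: l1_norm_def sum_nonneg)

lemma borel_measurable_vec_lambda [measurable (raw)]:
  fixes f :: "'l::finite \<Rightarrow> 'w \<Rightarrow> real"
  assumes "\<And>l. f l \<in> borel_measurable M"
  shows "(\<lambda>\<omega>. \<chi> l. f l \<omega>) \<in> borel_measurable M"
  using assms by (subst borel_measurable_euclidean_space) (auto simp: Basis_vec_def inner_axis)

lemma borel_measurable_vec_nth [measurable (raw)]:
  fixes f :: "'w \<Rightarrow> real ^ 'l::finite"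
  shows "f \<in> borel_measurable M \<Longrightarrow> (\<lambda>\<omega>. f \<omega> $ l) \<in> borel_measurable M"
  by (rule borel_measurable_continuous_on[of "\<lambda>v. v $ l"]) (intro continuous_intros)

lemma l1_norm_le_norm: "l1_norm (q :: real ^ 'l::finite) \<le> real CARD('l) * norm q"
  unfolding l1_norm_def using sum_bounded_above[of UNIV "\<lambda>l. \<bar>q $ l\<bar>" "norm q"]
  by (simp add: component_le_norm_cart)

context bounded_renewal_systems
begin

lemma ymax_nonneg: "0 \<le> ymax"
proof -
  obtain a where "a \<in> space (A undefined)" using actions_nonempty by blast
  from penalty_rate_bound[OF this] show ?thesis by (meson abs_ge_zero order_trans)
qed

lemma zmax_nonneg: "0 \<le> zmax"
proof -
  obtain a where "a \<in> space (A undefined)" using actions_nonempty by blast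
  from metric_rate_bound[OF this] show ?thesis by (meson abs_ge_zero order_trans)
qed

lemma dmax_nonneg: "0 \<le> dmax"
proof -
  interpret D: prob_space D by (rule external_law)
  have "AE x in D. \<forall>l. \<bar>x $ l\<bar> \<le> dmax" using bounded by (simp add: bounded_systems_def)
  then have "AE x in D. 0 \<le> dmax" by eventually_elim (meson abs_ge_zero order_trans)
  then show ?thesis by simp
qed

lemma cost_rate_bound:
  assumes "a \<in> space (A n)" "0 \<le> V"
  shows "\<bar>V * penalty_rate (K n 0) a + q \<bullet> metric_rate (K n 0) a\<bar> \<le> V * ymax + zmax * l1_norm q"
proof -
  have "\<bar>V * penalty_rate (K n 0) a\<bar> \<le> V * ymax"
    using penalty_rate_bound[OF assms(1), of 0] assms(2) by (simp add: abs_mult mult_left_mono)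
  moreover have "\<bar>q \<bullet> metric_rate (K n 0) a\<bar> \<le> zmax * l1_norm q"
    using metric_rate_bound[OF assms(1)] by (intro abs_inner_le_l1_norm)
  ultimately show ?thesis by linarith
qed

lemma bdd_below_cost_rate:
  assumes "0 \<le> V"
  shows "bdd_below ((\<lambda>a. V * penalty_rate (K n 0) a + q \<bullet> metric_rate (K n 0) a) ` space (A n))"
proof (rule bdd_belowI2)
  show "- (V * ymax + zmax * l1_norm q) \<le> V * penalty_rate (K n 0) a + q \<bullet> metric_rate (K n 0) a"
    if "a \<in> space (A n)" for a
    using cost_rate_bound[OF that assms, of q] by linarith
qed

lemma min_cost_le:
  assumes "a \<in> space (A n)" "0 \<le> V"
  shows "min_cost V A K n q \<le> V * penalty_rate (K n 0) a + q \<bullet> metric_rate (K n 0) a"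
  unfolding min_cost_def by (rule cINF_lower[OF bdd_below_cost_rate]) fact+

lemma min_cost_arg_min:
  assumes "is_arg_min (\<lambda>a. V * penalty_rate (K n 0) a + q \<bullet> metric_rate (K n 0) a)
    (\<lambda>a. a \<in> space (A n)) a"
  shows "min_cost V A K n q = V * penalty_rate (K n 0) a + q \<bullet> metric_rate (K n 0) a"
  using assms unfolding min_cost_def is_arg_min_def
  by (intro cInf_eq_minimum) (auto simp: not_less)

lemma min_cost_bound:
  assumes "0 \<le> V"
  shows "\<bar>min_cost V A K n q\<bar> \<le> V * ymax + zmax * l1_norm q"
proof -
  obtain a where a: "a \<in> space (A n)" using actions_nonempty by blast
  have "- (V * ymax + zmax * l1_norm q) \<le> min_cost V A K n q"
    unfolding min_cost_def
  proof (rule cINF_greatest[OF actions_nonempty])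
    show "- (V * ymax + zmax * l1_norm q) \<le> V * penalty_rate (K n 0) a + q \<bullet> metric_rate (K n 0) a"
      if "a \<in> space (A n)" for a
      using cost_rate_bound[OF that assms, of q] by linarith
  qed
  moreover have "min_cost V A K n q \<le> V * ymax + zmax * l1_norm q"
    using min_cost_le[OF a assms, of q] cost_rate_bound[OF a assms, of q] by linarith
  ultimately show ?thesis by linarith
qed

text \<open>
  An infimum of affine functions of the prices whose slopes, the metric rates, are bounded by \<open>zmax\<close>.
\<close>
lemma min_cost_lipschitz:
  assumes "0 \<le> V"
  shows "\<bar>min_cost V A K n q - min_cost V A K n q'\<bar> \<le> zmax * l1_norm (q - q')"
proof -
  have "min_cost V A K n q - zmax * l1_norm (q - q') \<le> min_cost V A K n q'" for q q' :: "real ^ 'l"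
    unfolding min_cost_def[of _ _ _ _ q']
  proof (rule cINF_greatest[OF actions_nonempty])
    fix a assume a: "a \<in> space (A n)"
    have "\<bar>(q - q') \<bullet> metric_rate (K n 0) a\<bar> \<le> zmax * l1_norm (q - q')"
      using metric_rate_bound[OF a] by (intro abs_inner_le_l1_norm)
    with min_cost_le[OF a assms, of q]
    show "min_cost V A K n q - zmax * l1_norm (q - q') \<le>
        V * penalty_rate (K n 0) a + q' \<bullet> metric_rate (K n 0) a"
      by (simp add: inner_diff_left abs_le_iff)
  qed
  from this[of q q'] this[of q' q] show ?thesis
    by (auto simp: abs_le_iff l1_norm_def abs_minus_commute)
qed

lemma measurable_min_cost [measurable]:
  assumes "0 \<le> V"
  shows "min_cost V A K n \<in> borel_measurable borel"
proof -
  have "(zmax * real CARD('l))-lipschitz_on UNIV (min_cost V A K n)"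
  proof (rule lipschitz_onI)
    fix q q' :: "real ^ 'l"
    have "\<bar>min_cost V A K n q - min_cost V A K n q'\<bar> \<le> zmax * l1_norm (q - q')"
      by (rule min_cost_lipschitz[OF assms])
    also have "\<dots> \<le> zmax * (real CARD('l) * norm (q - q'))"
      by (intro mult_left_mono l1_norm_le_norm zmax_nonneg)
    finally show "dist (min_cost V A K n q) (min_cost V A K n q') \<le> zmax * real CARD('l) * dist q q'"
      by (simp add: dist_norm mult.assoc)
  qed (simp add: zmax_nonneg)
  then show ?thesis
    by (intro borel_measurable_continuous_onI lipschitz_on_continuous_on)
qed

end

section \<open>Frames with frozen prices\<close>

context bounded_decision_sequence
begin

lemma slot_in_frame:
  assumes "\<omega> \<in> space M"
  obtains k where "\<tau> n k \<omega> \<le> t" "t < \<tau> n (Suc k) \<omega>"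
proof -
  have step: "\<tau> n k \<omega> < \<tau> n (Suc k) \<omega>" for k using renewal_time_less[OF assms] .
  let ?k = "LEAST k. t < \<tau> n k \<omega>"
  have ex: "t < \<tau> n (Suc t) \<omega>"
    using renewal_index_le_time[of "\<lambda>k. \<tau> n k \<omega>", OF step, of "Suc t"] by simp
  have k: "t < \<tau> n ?k \<omega>" using ex by (rule LeastI)
  then obtain j where j: "?k = Suc j" using renewal_time_0[OF assms, of n] by (cases ?k) auto
  then have "\<not> t < \<tau> n j \<omega>" using not_less_Least[of j "\<lambda>k. t < \<tau> n k \<omega>"] by simp
  with k j that[of j] show ?thesis by simp
qed

lemma AE_slot_bounds:
  "AE \<omega> in M. \<forall>n t. \<bar>y n t \<omega>\<bar> \<le> ymax \<and> (\<forall>l. \<bar>z n t \<omega> $ l\<bar> \<le> zmax)"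
proof -
  let ?P = "\<lambda>x :: 'l frame. \<forall>i. i < fst x \<longrightarrow>
      \<bar>fst (snd x i)\<bar> \<le> ymax \<and> (\<forall>l. \<bar>snd (snd x i) $ l\<bar> \<le> zmax)"
  have [measurable]: "(\<lambda>x :: 'l frame. fst (snd x i)) \<in> borel_measurable frame_space" for i
    by (rule measurable_compose[OF measurable_frame_slot measurable_penalty_component])
  have [measurable]: "(\<lambda>x :: 'l frame. snd (snd x i) $ l) \<in> borel_measurable frame_space" for i l
    by (rule measurable_compose[OF measurable_frame_slot measurable_metric_component])
  have pred: "Measurable.pred frame_space ?P" by measurable
  have "AE \<omega> in M. ?P (outcome n k \<omega>)" for n k
  proof (rule AE_outcome[OF pred])
    fix a assume a: "a \<in> space (A n)"
    show "AE x in K n k a. ?P x"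
      using AE_frame_penalty[OF a, of k] AE_frame_metric[OF a, of k] by eventually_elim auto
  qed
  then have "AE \<omega> in M. \<forall>n k. ?P (outcome n k \<omega>)" by (simp add: AE_all_countable)
  then show ?thesis using AE_space
  proof eventually_elim
    case (elim \<omega>)
    show ?case
    proof (intro allI)
      fix n t
      obtain k where k: "\<tau> n k \<omega> \<le> t" "t < \<tau> n (Suc k) \<omega>" using slot_in_frame[OF elim(2)] .
      then have "t - \<tau> n k \<omega> < \<tau> n (Suc k) \<omega> - \<tau> n k \<omega>" by simp
      with elim(1)[rule_format, of "t - \<tau> n k \<omega>" n k] k
      show "\<bar>y n t \<omega>\<bar> \<le> ymax \<and> (\<forall>l. \<bar>z n t \<omega> $ l\<bar> \<le> zmax)"
        by (simp add: frame_outcome_def)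
    qed
  qed
qed

lemma AE_external_bound: "AE \<omega> in M. \<forall>t l. \<bar>d t \<omega> $ l\<bar> \<le> dmax"
proof -
  have "AE x in D. \<forall>l. \<bar>x $ l\<bar> \<le> dmax" using bounded by (simp add: bounded_systems_def)
  then have "AE \<omega> in M. \<forall>l. \<bar>d t \<omega> $ l\<bar> \<le> dmax" for t
    unfolding external_distr[of t, symmetric] by (subst (asm) AE_distr_iff) measurable
  then show ?thesis by (simp add: AE_all_countable)
qed

text \<open>
  The cost of slot \<open>t\<close> at the prices \<open>P s\<close>, measured relative to the best rate that these prices allow.
\<close>
definition frozen_cost :: "real \<Rightarrow> (nat \<Rightarrow> 'w \<Rightarrow> real ^ 'l) \<Rightarrow> 'n \<Rightarrow> nat \<Rightarrow> nat \<Rightarrow> 'w \<Rightarrow> real" where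
  "frozen_cost V P n t s \<omega> = V * y n t \<omega> + P s \<omega> \<bullet> z n t \<omega> - min_cost V A K n (P s \<omega>)"

definition frame_cost :: "real \<Rightarrow> (nat \<Rightarrow> 'w \<Rightarrow> real ^ 'l) \<Rightarrow> 'n \<Rightarrow> nat \<Rightarrow> 'w \<Rightarrow> real" where
  "frame_cost V P n k \<omega> =
     (\<Sum>i<\<tau> n (Suc k) \<omega> - \<tau> n k \<omega>. frozen_cost V P n (\<tau> n k \<omega> + i) (\<tau> n k \<omega>) \<omega>)"

text \<open>
  With prices frozen at the start of the frame, the frame cost is linear in the three frame
  sums with past-measurable coefficients. Its conditional mean is therefore the mean length times the
  gap between the rate of the chosen action and the best rate at these prices.
\<close>
lemma
  assumes V: "0 \<le> V" and P [measurable]: "P s \<in> borel_measurable (F s)"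
    and P_bnd: "AE \<omega> in M. \<forall>l. \<bar>P s \<omega> $ l\<bar> \<le> b"
  shows integrable_frame_cost: "integrable M (\<lambda>\<omega>. indicator (starts n k s) \<omega> * frame_cost V P n k \<omega>)"
    and integral_frame_cost: "(\<integral>\<omega>. indicator (starts n k s) \<omega> * frame_cost V P n k \<omega> \<partial>M) =
      (\<integral>\<omega>. indicator (starts n k s) \<omega> * (mean_length (K n 0) (\<alpha> n k \<omega>) *
        (V * penalty_rate (K n 0) (\<alpha> n k \<omega>) + P s \<omega> \<bullet> metric_rate (K n 0) (\<alpha> n k \<omega>)
          - min_cost V A K n (P s \<omega>))) \<partial>M)"
proof -
  let ?I = "indicator (starts n k s) :: _ \<Rightarrow> real"
  let ?y = "frame_sum fst :: 'l frame \<Rightarrow> real"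
  let ?z = "\<lambda>l. frame_sum (\<lambda>p. snd p $ l) :: 'l frame \<Rightarrow> real"
  let ?T = "\<lambda>x :: 'l frame. real (fst x)"
  let ?m = "\<lambda>\<omega>. min_cost V A K n (P s \<omega>)"
  let ?E = "\<lambda>h \<omega>. \<integral>x. h x \<partial>K n k (\<alpha> n k \<omega>)"
  have my: "?y \<in> borel_measurable frame_space" and mz: "?z l \<in> borel_measurable frame_space" for l
    by measurable
  have mT: "?T \<in> borel_measurable frame_space"
    by (intro measurable_compose[OF measurable_frame_length]) simp
  have ybnd: "AE x in K n k a. \<bar>?y x\<bar> \<le> ymax * real (fst x)" if "a \<in> space (A n)" for a
    using AE_frame_penalty[OF that, of k] by (rule AE_frame_sum_bound)
  have bz: "AE x in K n k a. \<bar>?z l x\<bar> \<le> zmax * real (fst x)" if "a \<in> space (A n)" for a l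
    using AE_frame_metric[OF that, of k] by (intro AE_frame_sum_bound) (auto elim: eventually_mono)
  have bT: "AE x in K n k a. \<bar>?T x\<bar> \<le> 1 * real (fst x)" for a by simp
  have mP: "(\<lambda>\<omega>. P s \<omega> $ l) \<in> borel_measurable (F s)" for l by measurable
  have mm: "?m \<in> borel_measurable (F s)"
    by (rule measurable_compose[OF P measurable_min_cost[OF V]])
  have bP: "AE \<omega> in M. \<bar>P s \<omega> $ l\<bar> \<le> b" for l using P_bnd by (auto elim: eventually_mono)
  have bm: "AE \<omega> in M. \<bar>?m \<omega>\<bar> \<le> V * ymax + zmax * (real CARD('l) * b)"
    using P_bnd
  proof eventually_elim
    case (elim \<omega>)
    have "l1_norm (P s \<omega>) \<le> real CARD('l) * b"
      unfolding l1_norm_def using elim sum_bounded_above[of UNIV "\<lambda>l. \<bar>P s \<omega> $ l\<bar>" b] by simp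
    then show ?case
      using min_cost_bound[OF V, of n "P s \<omega>"] mult_left_mono[OF _ zmax_nonneg] by fastforce
  qed
  have mV: "(\<lambda>\<omega>. V) \<in> borel_measurable (F s)" and bV: "AE \<omega> in M. \<bar>V\<bar> \<le> \<bar>V\<bar>" by simp_all
  note iy = integrable_weighted_frame[OF my ybnd mV bV]
    integral_weighted_frame[OF my ybnd mV bV]
  note iz = integrable_weighted_frame[OF mz bz mP bP]
    integral_weighted_frame[OF mz bz mP bP]
  note iT = integrable_weighted_frame[OF mT bT mm bm]
    integral_weighted_frame[OF mT bT mm bm]
  have lhs: "?I \<omega> * frame_cost V P n k \<omega> = V * (?I \<omega> * ?y (outcome n k \<omega>)) +
      (\<Sum>l\<in>UNIV. P s \<omega> $ l * (?I \<omega> * ?z l (outcome n k \<omega>))) -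
      ?m \<omega> * (?I \<omega> * ?T (outcome n k \<omega>))" for \<omega>
  proof (cases "\<omega> \<in> starts n k s")
    case True
    then have "frame_cost V P n k \<omega> = V * ?y (outcome n k \<omega>) +
      (\<Sum>i<fst (outcome n k \<omega>). \<Sum>l\<in>UNIV. P s \<omega> $ l * snd (snd (outcome n k \<omega>) i) $ l) -
      ?m \<omega> * ?T (outcome n k \<omega>)"
      by (simp add: frame_cost_def frozen_cost_def frame_outcome_def sum.distrib sum_subtractf
          sum_distrib_left inner_vec_def)
    also have "(\<Sum>i<fst (outcome n k \<omega>). \<Sum>l\<in>UNIV. P s \<omega> $ l * snd (snd (outcome n k \<omega>) i) $ l) =
        (\<Sum>l\<in>UNIV. P s \<omega> $ l * ?z l (outcome n k \<omega>))"
      by (subst sum.swap) (simp add: sum_distrib_left)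
    finally show ?thesis using True by simp
  qed simp
  have rhs: "?I \<omega> * (mean_length (K n 0) (\<alpha> n k \<omega>) *
        (V * penalty_rate (K n 0) (\<alpha> n k \<omega>) + P s \<omega> \<bullet> metric_rate (K n 0) (\<alpha> n k \<omega>) - ?m \<omega>)) =
      V * (?I \<omega> * ?E ?y \<omega>) + (\<Sum>l\<in>UNIV. P s \<omega> $ l * (?I \<omega> * ?E (?z l) \<omega>)) -
      ?m \<omega> * (?I \<omega> * ?E ?T \<omega>)" if "\<omega> \<in> space M" for \<omega>
  proof (cases "\<omega> \<in> starts n k s")
    case True
    have a: "\<alpha> n k \<omega> \<in> space (A n)" using that by (rule action_mem)
    let ?a = "\<alpha> n k \<omega>" and ?L = "mean_length (K n 0) (\<alpha> n k \<omega>)"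
    have L: "?L \<noteq> 0" using mean_length_ge_1[OF a, of 0] by simp
    have "?L * penalty_rate (K n 0) ?a = ?E ?y \<omega>"
      using L mean_penalty_indep[OF a, of k] by (simp add: penalty_rate_def mean_penalty_def)
    moreover have "?L * (P s \<omega> \<bullet> metric_rate (K n 0) ?a) = P s \<omega> \<bullet> mean_metric (K n k) ?a"
      using L mean_metric_indep[OF a, of k] by (simp add: metric_rate_def)
    then have "?L * (P s \<omega> \<bullet> metric_rate (K n 0) ?a) = (\<Sum>l\<in>UNIV. P s \<omega> $ l * ?E (?z l) \<omega>)"
      by (simp add: inner_vec_def mean_metric_component[OF a])
    moreover have "?L = ?E ?T \<omega>"
      using mean_length_indep[OF a, of k] by (simp add: mean_length_def)
    ultimately show ?thesis using True by (simp add: algebra_simps)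
  qed simp
  show "integrable M (\<lambda>\<omega>. ?I \<omega> * frame_cost V P n k \<omega>)"
    unfolding lhs by (intro Bochner_Integration.integrable_add Bochner_Integration.integrable_diff
        Bochner_Integration.integrable_sum iy iz iT)
  have "(\<integral>\<omega>. ?I \<omega> * frame_cost V P n k \<omega> \<partial>M) =
      (\<integral>\<omega>. V * (?I \<omega> * ?y (outcome n k \<omega>)) \<partial>M) +
      (\<Sum>l\<in>UNIV. \<integral>\<omega>. P s \<omega> $ l * (?I \<omega> * ?z l (outcome n k \<omega>)) \<partial>M) -
      (\<integral>\<omega>. ?m \<omega> * (?I \<omega> * ?T (outcome n k \<omega>)) \<partial>M)"
    unfolding lhs using iy iz iT by simp
  also have "\<dots> = (\<integral>\<omega>. V * (?I \<omega> * ?E ?y \<omega>) \<partial>M) +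
      (\<Sum>l\<in>UNIV. \<integral>\<omega>. P s \<omega> $ l * (?I \<omega> * ?E (?z l) \<omega>) \<partial>M) - (\<integral>\<omega>. ?m \<omega> * (?I \<omega> * ?E ?T \<omega>) \<partial>M)"
    by (simp only: iy(3) iz(3) iT(3))
  also have "\<dots> = (\<integral>\<omega>. V * (?I \<omega> * ?E ?y \<omega>) +
      (\<Sum>l\<in>UNIV. P s \<omega> $ l * (?I \<omega> * ?E (?z l) \<omega>)) - ?m \<omega> * (?I \<omega> * ?E ?T \<omega>) \<partial>M)"
    using iy iz iT by simp
  also have "\<dots> = (\<integral>\<omega>. ?I \<omega> * (mean_length (K n 0) (\<alpha> n k \<omega>) *
        (V * penalty_rate (K n 0) (\<alpha> n k \<omega>) + P s \<omega> \<bullet> metric_rate (K n 0) (\<alpha> n k \<omega>)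
          - ?m \<omega>)) \<partial>M)"
    by (intro Bochner_Integration.integral_cong refl rhs[symmetric])
  finally show "(\<integral>\<omega>. ?I \<omega> * frame_cost V P n k \<omega> \<partial>M) = \<dots>" .
qed

definition frames_cost :: "real \<Rightarrow> (nat \<Rightarrow> 'w \<Rightarrow> real ^ 'l) \<Rightarrow> 'n \<Rightarrow> nat \<Rightarrow> 'w \<Rightarrow> real" where
  "frames_cost V P n T \<omega> = (\<Sum>k<T. if \<tau> n k \<omega> < T then frame_cost V P n k \<omega> else 0)"

definition sq_lengths :: "'n \<Rightarrow> nat \<Rightarrow> 'w \<Rightarrow> real" where
  "sq_lengths n T \<omega> =
     (\<Sum>k<T. if \<tau> n k \<omega> < T then (real (\<tau> n (Suc k) \<omega> - \<tau> n k \<omega>))\<^sup>2 else 0)"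

definition overshoot :: "'n \<Rightarrow> nat \<Rightarrow> 'w \<Rightarrow> real" where
  "overshoot n T \<omega> = (\<Sum>k<T. if \<tau> n k \<omega> < T then real (\<tau> n (Suc k) \<omega> - T) else 0)"

text \<open>
  The renewal property is available only for deterministic starting times; this splits the event that a frame
  starts before \<open>T\<close> accordingly.
\<close>
lemma if_started_eq_sum:
  fixes f :: "nat \<Rightarrow> 'b::semiring_1"
  assumes "\<omega> \<in> space M"
  shows "(if \<tau> n k \<omega> < T then f (\<tau> n k \<omega>) else 0) =
    (\<Sum>s<T. indicator (starts n k s) \<omega> * f s)"
proof -
  have "(\<Sum>s<T. indicator (starts n k s) \<omega> * f s) = (\<Sum>s<T. if s = \<tau> n k \<omega> then f s else 0)"
    using assms by (intro sum.cong) (auto simp: indicator_def)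
  then show ?thesis by simp
qed

lemma nn_integral_started:
  assumes h [measurable]: "\<And>s. h s \<in> borel_measurable frame_space"
  shows "(\<integral>\<^sup>+\<omega>. (if \<tau> n k \<omega> < T then h (\<tau> n k \<omega>) (outcome n k \<omega>) else 0) \<partial>M) =
    (\<Sum>s<T. \<integral>\<^sup>+\<omega>\<in>starts n k s. (\<integral>\<^sup>+x. h s x \<partial>K n k (\<alpha> n k \<omega>)) \<partial>M)"
proof -
  have "(\<integral>\<^sup>+\<omega>. (if \<tau> n k \<omega> < T then h (\<tau> n k \<omega>) (outcome n k \<omega>) else 0) \<partial>M) =
      (\<integral>\<^sup>+\<omega>. (\<Sum>s<T. h s (outcome n k \<omega>) * indicator (starts n k s) \<omega>) \<partial>M)"
  proof (rule nn_integral_cong)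
    fix \<omega> assume "\<omega> \<in> space M"
    from if_started_eq_sum[OF this, of n k T "\<lambda>s. h s (outcome n k \<omega>)"]
    show "(if \<tau> n k \<omega> < T then h (\<tau> n k \<omega>) (outcome n k \<omega>) else 0) =
        (\<Sum>s<T. h s (outcome n k \<omega>) * indicator (starts n k s) \<omega>)"
      by (simp add: mult.commute)
  qed
  also have "\<dots> = (\<Sum>s<T. \<integral>\<^sup>+\<omega>\<in>starts n k s. h s (outcome n k \<omega>) \<partial>M)"
    by (rule nn_integral_sum) measurable
  also have "\<dots> = (\<Sum>s<T. \<integral>\<^sup>+\<omega>\<in>starts n k s. (\<integral>\<^sup>+x. h s x \<partial>K n k (\<alpha> n k \<omega>)) \<partial>M)"
    by (intro sum.cong refl nn_integral_frame[OF starts_in_F]) auto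
  finally show ?thesis .
qed

lemma measurable_started [measurable]:
  fixes f :: "nat \<Rightarrow> nat \<Rightarrow> real"
  shows "(\<lambda>\<omega>. if \<tau> n k \<omega> < T then f (\<tau> n k \<omega>) (\<tau> n (Suc k) \<omega>) else 0) \<in> borel_measurable M"
  by measurable

lemma measurable_frame_function:
  "(\<lambda>x. f (fst x)) \<in> borel_measurable (frame_space :: 'l frame measure)" for f :: "nat \<Rightarrow> 'b::topological_space"
  by (intro measurable_compose[OF measurable_frame_length]) simp

lemma measurable_sq_lengths [measurable]: "sq_lengths n T \<in> borel_measurable M"
  unfolding sq_lengths_def[abs_def] by (intro borel_measurable_sum measurable_started)

lemma measurable_overshoot [measurable]: "overshoot n T \<in> borel_measurable M"
  unfolding overshoot_def[abs_def]
  using measurable_started[of n _ T "\<lambda>_ s. real (s - T)"] by (intro borel_measurable_sum) auto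

lemma integral_le_if_nn_integral_le:
  assumes [measurable]: "f \<in> borel_measurable M" and nonneg: "\<And>\<omega>. 0 \<le> f \<omega>"
    and le: "(\<integral>\<^sup>+\<omega>. ennreal (f \<omega>) \<partial>M) \<le> ennreal c" and "0 \<le> c"
  shows "integrable M f" "(\<integral>\<omega>. f \<omega> \<partial>M) \<le> c"
proof -
  show int: "integrable M f"
    using nonneg le by (intro integrableI_bounded) (auto simp: le_less_trans)
  show "(\<integral>\<omega>. f \<omega> \<partial>M) \<le> c"
    using le nn_integral_eq_integral[OF int] nonneg \<open>0 \<le> c\<close> by simp
qed

text \<open>
  Frame \<open>k\<close> starts no earlier than slot \<open>k\<close>, so at most \<open>T\<close> frames start before \<open>T\<close>, and each has second moment at
  most \<open>B\<close>.
\<close>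
lemma sq_lengths_expectation:
  "integrable M (sq_lengths n T)" "(\<integral>\<omega>. sq_lengths n T \<omega> \<partial>M) \<le> B * real T"
proof -
  have frame: "(\<integral>\<^sup>+\<omega>. (if \<tau> n k \<omega> < T then ennreal ((real (\<tau> n (Suc k) \<omega> - \<tau> n k \<omega>))\<^sup>2) else 0) \<partial>M) \<le> ennreal B"
    for k
  proof -
    have "(\<integral>\<^sup>+\<omega>. (if \<tau> n k \<omega> < T then ennreal ((real (\<tau> n (Suc k) \<omega> - \<tau> n k \<omega>))\<^sup>2) else 0) \<partial>M) =
        (\<Sum>s<T. \<integral>\<^sup>+\<omega>\<in>starts n k s. (\<integral>\<^sup>+x. ennreal ((real (fst x))\<^sup>2) \<partial>K n k (\<alpha> n k \<omega>)) \<partial>M)"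
      using nn_integral_started[of "\<lambda>_ x. ennreal ((real (fst x))\<^sup>2)" n k T, OF measurable_frame_function]
      by (simp only: frame_outcome_def fst_conv)
    also have "\<dots> \<le> (\<Sum>s<T. \<integral>\<^sup>+\<omega>\<in>starts n k s. ennreal B \<partial>M)"
      by (intro sum_mono nn_integral_mono mult_right_mono second_moment action_mem) auto
    also have "\<dots> = (\<integral>\<^sup>+\<omega>. (\<Sum>s<T. ennreal B * indicator (starts n k s) \<omega>) \<partial>M)"
      by (rule nn_integral_sum[symmetric]) measurable
    also have "\<dots> \<le> (\<integral>\<^sup>+\<omega>. ennreal B \<partial>M)"
    proof (rule nn_integral_mono)
      fix \<omega> assume "\<omega> \<in> space M"
      then have "(\<Sum>s<T. ennreal B * indicator (starts n k s) \<omega>) =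
          (if \<tau> n k \<omega> < T then ennreal B else 0)"
        using if_started_eq_sum[of \<omega> n k T "\<lambda>_. ennreal B"] by (simp only: mult.commute[of "ennreal B"])
      then show "(\<Sum>s<T. ennreal B * indicator (starts n k s) \<omega>) \<le> ennreal B"
        by (simp only: split: if_split) simp
    qed
    also have "\<dots> = ennreal B" by (simp add: emeasure_space_1)
    finally show ?thesis .
  qed
  have "(\<integral>\<^sup>+\<omega>. ennreal (sq_lengths n T \<omega>) \<partial>M) = (\<integral>\<^sup>+\<omega>. (\<Sum>k<T.
      if \<tau> n k \<omega> < T then ennreal ((real (\<tau> n (Suc k) \<omega> - \<tau> n k \<omega>))\<^sup>2) else 0) \<partial>M)"
    unfolding sq_lengths_def
    by (intro nn_integral_cong) (auto simp flip: sum_ennreal intro!: sum.cong)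
  also have "\<dots> = (\<Sum>k<T. \<integral>\<^sup>+\<omega>.
      (if \<tau> n k \<omega> < T then ennreal ((real (\<tau> n (Suc k) \<omega> - \<tau> n k \<omega>))\<^sup>2) else 0) \<partial>M)"
    by (rule nn_integral_sum) measurable
  also have "\<dots> \<le> (\<Sum>k<T. ennreal B)" by (intro sum_mono frame)
  also have "\<dots> = ennreal (B * real T)"
    using B_ge_1 by (simp add: ennreal_of_nat_eq_real_of_nat ennreal_mult'[symmetric] mult.commute)
  finally have le: "(\<integral>\<^sup>+\<omega>. ennreal (sq_lengths n T \<omega>) \<partial>M) \<le> ennreal (B * real T)" .
  have "0 \<le> sq_lengths n T \<omega>" for \<omega> unfolding sq_lengths_def by (intro sum_nonneg) auto
  from integral_le_if_nn_integral_le[OF _ this le] B_ge_1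
  show "integrable M (sq_lengths n T)" "(\<integral>\<omega>. sq_lengths n T \<omega> \<partial>M) \<le> B * real T" by auto
qed

lemma overshoot_nonneg: "0 \<le> overshoot n T \<omega>"
  unfolding overshoot_def by (intro sum_nonneg) auto

lemma overshoot_le_sq: "overshoot n T \<omega> \<le> (overshoot n T \<omega>)\<^sup>2"
proof -
  have "overshoot n T \<omega> = real (\<Sum>k<T. if \<tau> n k \<omega> < T then \<tau> n (Suc k) \<omega> - T else 0)"
    by (auto simp: overshoot_def intro!: sum.cong)
  moreover have "real j \<le> (real j)\<^sup>2" for j
    by (metis le_square of_nat_le_iff of_nat_mult power2_eq_square)
  ultimately show ?thesis by (simp only:)
qed

text \<open>
  A frame that starts in slot \<open>s < T\<close> overshoots \<open>T\<close> by its residual life at age \<open>T - s\<close>, whose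
  second moment is at most \<open>B\<close> times the probability of reaching that age. These
  probabilities belong to disjoint events over all \<open>k\<close> and \<open>s\<close>, so the bound does not grow with \<open>T\<close>.
\<close>
lemma overshoot_sq_expectation:
  "integrable M (\<lambda>\<omega>. (overshoot n T \<omega>)\<^sup>2)" "(\<integral>\<omega>. (overshoot n T \<omega>)\<^sup>2 \<partial>M) \<le> B"
proof -
  let ?D = "\<lambda>k s. {\<omega> \<in> starts n k s. T - s \<le> fst (outcome n k \<omega>)}"
  have D [measurable]: "?D k s \<in> sets M" for k s
    by (simp add: frame_outcome_def) measurable
  have frame: "(\<integral>\<^sup>+\<omega>. (if \<tau> n k \<omega> < T then ennreal ((real (\<tau> n (Suc k) \<omega> - T))\<^sup>2) else 0) \<partial>M) \<le>
      ennreal B * (\<Sum>s<T. emeasure M (?D k s))" for k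
  proof -
    let ?h = "\<lambda>s x :: 'l frame. ennreal ((real (fst x - (T - s)))\<^sup>2)"
    have "(\<integral>\<^sup>+\<omega>. (if \<tau> n k \<omega> < T then ennreal ((real (\<tau> n (Suc k) \<omega> - T))\<^sup>2) else 0) \<partial>M) =
        (\<integral>\<^sup>+\<omega>. (if \<tau> n k \<omega> < T then ?h (\<tau> n k \<omega>) (outcome n k \<omega>) else 0) \<partial>M)"
      using renewal_time_less[of _ n k] by (intro nn_integral_cong) (auto simp: frame_outcome_def)
    also have "\<dots> = (\<Sum>s<T. \<integral>\<^sup>+\<omega>\<in>starts n k s. (\<integral>\<^sup>+x. ?h s x \<partial>K n k (\<alpha> n k \<omega>)) \<partial>M)"
      by (rule nn_integral_started) (rule measurable_frame_function)
    also have "\<dots> \<le> (\<Sum>s<T. \<integral>\<^sup>+\<omega>\<in>starts n k s. ennreal B *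
        emeasure (K n k (\<alpha> n k \<omega>)) {x \<in> space frame_space. fst x \<ge> T - s} \<partial>M)"
      by (intro sum_mono nn_integral_mono mult_right_mono residual_life action_mem) auto
    also have "\<dots> = (\<Sum>s<T. ennreal B * (\<integral>\<^sup>+\<omega>\<in>starts n k s.
        emeasure (K n k (\<alpha> n k \<omega>)) {x \<in> space frame_space. fst x \<ge> T - s} \<partial>M))"
    proof (intro sum.cong refl)
      fix s
      have [measurable]: "{x \<in> space frame_space. fst x \<ge> T - s} \<in> sets (frame_space :: 'l frame measure)"
        by measurable
      have "(\<lambda>\<omega>. emeasure (K n k (\<alpha> n k \<omega>)) {x \<in> space frame_space. fst x \<ge> T - s}) \<in> borel_measurable M"
        by (rule measurable_compose[OF measurable_kernel_action measurable_emeasure_subprob_algebra]) simp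
      then show "(\<integral>\<^sup>+\<omega>\<in>starts n k s. ennreal B *
          emeasure (K n k (\<alpha> n k \<omega>)) {x \<in> space frame_space. fst x \<ge> T - s} \<partial>M) =
        ennreal B * (\<integral>\<^sup>+\<omega>\<in>starts n k s.
          emeasure (K n k (\<alpha> n k \<omega>)) {x \<in> space frame_space. fst x \<ge> T - s} \<partial>M)"
        by (subst nn_integral_cmult[symmetric]) (auto simp: mult.assoc)
    qed
    also have "\<dots> = (\<Sum>s<T. ennreal B * emeasure M (?D k s))"
    proof (intro sum.cong refl arg_cong2[where f = "(*)"])
      fix s
      let ?S = "{x \<in> space frame_space. fst x \<ge> T - s} :: 'l frame set"
      have S: "?S \<in> sets frame_space" by measurable
      have "?D k s = {\<omega> \<in> starts n k s. outcome n k \<omega> \<in> ?S}"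
        using measurable_space[OF measurable_outcome] by auto
      then show "(\<integral>\<^sup>+\<omega>\<in>starts n k s. emeasure (K n k (\<alpha> n k \<omega>)) ?S \<partial>M) = emeasure M (?D k s)"
        using renewal[OF starts_in_F subset_refl S] by simp
    qed
    finally show ?thesis by (simp add: sum_distrib_left)
  qed
  have step: "\<tau> n k \<omega> < \<tau> n (Suc k) \<omega>" if "\<omega> \<in> space M" for \<omega> k using renewal_time_less[OF that] .
  have "(\<Sum>k<T. \<Sum>s<T. emeasure M (?D k s)) = (\<integral>\<^sup>+\<omega>. (\<Sum>k<T. \<Sum>s<T. indicator (?D k s) \<omega>) \<partial>M)"
    by (simp add: nn_integral_sum)
  also have "\<dots> \<le> (\<integral>\<^sup>+\<omega>. 1 \<partial>M)"
  proof (rule nn_integral_mono)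
    fix \<omega> assume \<omega>: "\<omega> \<in> space M"
    have "(\<Sum>s<T. indicator (?D k s) \<omega>) = (if \<tau> n k \<omega> < T \<and> T \<le> \<tau> n (Suc k) \<omega> then 1 else 0 :: ennreal)" for k
    proof -
      have "(\<Sum>s<T. indicator (?D k s) \<omega> :: ennreal) =
          (\<Sum>s<T. indicator (starts n k s) \<omega> * (if T - s \<le> fst (outcome n k \<omega>) then 1 else 0))"
        by (intro sum.cong refl) (auto simp: indicator_def)
      also have "\<dots> = (if \<tau> n k \<omega> < T then if T - \<tau> n k \<omega> \<le> fst (outcome n k \<omega>) then 1 else 0 else 0)"
        by (rule if_started_eq_sum[OF \<omega>, symmetric])
      finally show ?thesis using step[OF \<omega>, of k] by (auto simp: frame_outcome_def)
    qed
    then have "(\<Sum>k<T. \<Sum>s<T. indicator (?D k s) \<omega> :: ennreal) =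
        of_nat (card {k \<in> {..<T}. \<tau> n k \<omega> < T \<and> T \<le> \<tau> n (Suc k) \<omega>})"
      by (simp add: sum.If_cases Int_def)
    also have "\<dots> \<le> of_nat 1"
      using step[OF \<omega>] by (intro of_nat_mono at_most_one_straddling_frame)
    finally show "(\<Sum>k<T. \<Sum>s<T. indicator (?D k s) \<omega> :: ennreal) \<le> 1" by simp
  qed
  finally have prob: "(\<Sum>k<T. \<Sum>s<T. emeasure M (?D k s)) \<le> 1" by (simp add: emeasure_space_1)
  have "(\<integral>\<^sup>+\<omega>. ennreal ((overshoot n T \<omega>)\<^sup>2) \<partial>M) = (\<integral>\<^sup>+\<omega>. (\<Sum>k<T.
      if \<tau> n k \<omega> < T then ennreal ((real (\<tau> n (Suc k) \<omega> - T))\<^sup>2) else 0) \<partial>M)"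
  proof (rule nn_integral_cong)
    fix \<omega> assume "\<omega> \<in> space M"
    from overshoot_squared[of "\<lambda>k. \<tau> n k \<omega>" T, OF step[OF this]]
    show "ennreal ((overshoot n T \<omega>)\<^sup>2) = (\<Sum>k<T.
        if \<tau> n k \<omega> < T then ennreal ((real (\<tau> n (Suc k) \<omega> - T))\<^sup>2) else 0)"
      unfolding overshoot_def by (simp only:) (auto simp flip: sum_ennreal intro!: sum.cong)
  qed
  also have "\<dots> = (\<Sum>k<T. \<integral>\<^sup>+\<omega>.
      (if \<tau> n k \<omega> < T then ennreal ((real (\<tau> n (Suc k) \<omega> - T))\<^sup>2) else 0) \<partial>M)"
    by (rule nn_integral_sum) measurable
  also have "\<dots> \<le> (\<Sum>k<T. ennreal B * (\<Sum>s<T. emeasure M (?D k s)))" by (intro sum_mono frame)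
  also have "\<dots> = ennreal B * (\<Sum>k<T. \<Sum>s<T. emeasure M (?D k s))" by (simp add: sum_distrib_left)
  also have "\<dots> \<le> ennreal B * 1" by (intro mult_left_mono prob) simp
  finally have le: "(\<integral>\<^sup>+\<omega>. ennreal ((overshoot n T \<omega>)\<^sup>2) \<partial>M) \<le> ennreal B" by simp
  from integral_le_if_nn_integral_le[OF _ _ le] B_ge_1
  show "integrable M (\<lambda>\<omega>. (overshoot n T \<omega>)\<^sup>2)" "(\<integral>\<omega>. (overshoot n T \<omega>)\<^sup>2 \<partial>M) \<le> B" by auto
qed

lemma overshoot_expectation:
  "integrable M (overshoot n T)" "(\<integral>\<omega>. overshoot n T \<omega> \<partial>M) \<le> B"
proof -
  show int: "integrable M (overshoot n T)"
    using overshoot_le_sq overshoot_nonneg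
    by (intro Bochner_Integration.integrable_bound[OF overshoot_sq_expectation(1)]) auto
  show "(\<integral>\<omega>. overshoot n T \<omega> \<partial>M) \<le> B"
    by (rule order_trans[OF integral_mono[OF int overshoot_sq_expectation(1) overshoot_le_sq]
          overshoot_sq_expectation(2)])
qed

lemma AE_freeze_prices:
  assumes V: "0 \<le> V" and c: "0 \<le> c"
    and lip: "AE \<omega> in M. \<forall>s s' l. s \<le> s' \<longrightarrow> \<bar>P s \<omega> $ l - P s' \<omega> $ l\<bar> \<le> c * real (s' - s)"
  shows "AE \<omega> in M. \<bar>(\<Sum>t<T. frozen_cost V P n t t \<omega>) - frames_cost V P n T \<omega>\<bar> \<le>
    2 * zmax * (real CARD('l) * c) * sq_lengths n T \<omega> +
    2 * (V * ymax + zmax * l1_norm (P T \<omega>)) * overshoot n T \<omega>"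
  using lip AE_slot_bounds AE_space
proof eventually_elim
  case (elim \<omega>)
  note yb = elim(2)[rule_format, THEN conjunct1]
  note zb = elim(2)[rule_format, THEN conjunct2, rule_format]
  let ?c = "2 * zmax * (real CARD('l) * c)"
  let ?b = "2 * (V * ymax + zmax * l1_norm (P T \<omega>))"
  have "\<bar>(\<Sum>t<T. frozen_cost V P n t t \<omega>) - frames_cost V P n T \<omega>\<bar> \<le>
      (\<Sum>k<T. if \<tau> n k \<omega> < T then ?c * (real (\<tau> n (Suc k) \<omega> - \<tau> n k \<omega>))\<^sup>2 +
        ?b * real (\<tau> n (Suc k) \<omega> - T) else 0)"
    unfolding frames_cost_def frame_cost_def
  proof (rule freeze_prices_in_frames[of "\<lambda>k. \<tau> n k \<omega>" "\<lambda>t s. frozen_cost V P n t s \<omega>"])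
    show "\<tau> n 0 \<omega> = 0" "\<And>k. \<tau> n k \<omega> < \<tau> n (Suc k) \<omega>"
      using renewal_time_0 renewal_time_less elim(3) by auto
    show "0 \<le> ?c" using zmax_nonneg c by simp
    fix t
    have "\<bar>V * y n t \<omega>\<bar> \<le> V * ymax"
      using yb[of n t] V by (simp add: abs_mult mult_left_mono)
    moreover have "\<bar>P T \<omega> \<bullet> z n t \<omega>\<bar> \<le> zmax * l1_norm (P T \<omega>)"
      using zb by (intro abs_inner_le_l1_norm)
    ultimately show "\<bar>frozen_cost V P n t T \<omega>\<bar> \<le> ?b"
      unfolding frozen_cost_def using min_cost_bound[OF V, of n "P T \<omega>"] by (simp add: algebra_simps)
    fix s s' :: nat assume s: "s \<le> s'"
    have "l1_norm (P s \<omega> - P s' \<omega>) \<le> real CARD('l) * (c * real (s' - s))"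
      unfolding l1_norm_def
      using sum_bounded_above[of UNIV "\<lambda>l. \<bar>(P s \<omega> - P s' \<omega>) $ l\<bar>" "c * real (s' - s)"] elim(1) s
      by simp
    then have l1: "zmax * l1_norm (P s \<omega> - P s' \<omega>) \<le> zmax * (real CARD('l) * (c * real (s' - s)))"
      by (rule mult_left_mono[OF _ zmax_nonneg])
    have "\<bar>(P s \<omega> - P s' \<omega>) \<bullet> z n t \<omega>\<bar> \<le> zmax * l1_norm (P s \<omega> - P s' \<omega>)"
      using zb by (intro abs_inner_le_l1_norm)
    then have "\<bar>frozen_cost V P n t s \<omega> - frozen_cost V P n t s' \<omega>\<bar> \<le> 2 * (zmax * l1_norm (P s \<omega> - P s' \<omega>))"
      using min_cost_lipschitz[OF V, of n "P s \<omega>" "P s' \<omega>"]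
      by (simp add: frozen_cost_def inner_diff_left)
    with l1 show "\<bar>frozen_cost V P n t s \<omega> - frozen_cost V P n t s' \<omega>\<bar> \<le> ?c * real (s' - s)"
      by (simp add: algebra_simps)
  qed
  also have "\<dots> = ?c * sq_lengths n T \<omega> + ?b * overshoot n T \<omega>"
    unfolding sq_lengths_def overshoot_def sum_distrib_left sum.distrib[symmetric]
    by (intro sum.cong) auto
  finally show ?case .
qed

definition adapted_prices :: "(nat \<Rightarrow> 'w \<Rightarrow> real ^ 'l) \<Rightarrow> bool" where
  "adapted_prices P \<longleftrightarrow> (\<forall>s. P s \<in> borel_measurable (F s) \<and>
     (\<exists>b. AE \<omega> in M. \<forall>l. \<bar>P s \<omega> $ l\<bar> \<le> b))"

lemma integral_frames_cost:
  assumes V: "0 \<le> V" and P: "adapted_prices P"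
  shows "integrable M (frames_cost V P n T)"
    and "(\<integral>\<omega>. frames_cost V P n T \<omega> \<partial>M) = (\<Sum>k<T. \<Sum>s<T.
      \<integral>\<omega>. indicator (starts n k s) \<omega> * (mean_length (K n 0) (\<alpha> n k \<omega>) *
        (V * penalty_rate (K n 0) (\<alpha> n k \<omega>) + P s \<omega> \<bullet> metric_rate (K n 0) (\<alpha> n k \<omega>)
          - min_cost V A K n (P s \<omega>))) \<partial>M)"
proof -
  have int: "integrable M (\<lambda>\<omega>. indicator (starts n k s) \<omega> * frame_cost V P n k \<omega>)" for k s
    using P integrable_frame_cost[OF V] unfolding adapted_prices_def by blast
  have eq: "frames_cost V P n T \<omega> = (\<Sum>k<T. \<Sum>s<T. indicator (starts n k s) \<omega> * frame_cost V P n k \<omega>)"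
    if "\<omega> \<in> space M" for \<omega>
    unfolding frames_cost_def
    by (intro sum.cong refl) (rule if_started_eq_sum[OF that])
  show "integrable M (frames_cost V P n T)"
    by (subst Bochner_Integration.integrable_cong[OF refl eq])
      (assumption, intro Bochner_Integration.integrable_sum int)
  have "(\<integral>\<omega>. frames_cost V P n T \<omega> \<partial>M) =
      (\<Sum>k<T. \<Sum>s<T. \<integral>\<omega>. indicator (starts n k s) \<omega> * frame_cost V P n k \<omega> \<partial>M)"
    by (subst Bochner_Integration.integral_cong[OF refl eq], assumption)
      (simp only: Bochner_Integration.integral_sum Bochner_Integration.integrable_sum int)
  also have "\<dots> = (\<Sum>k<T. \<Sum>s<T.
      \<integral>\<omega>. indicator (starts n k s) \<omega> * (mean_length (K n 0) (\<alpha> n k \<omega>) *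
        (V * penalty_rate (K n 0) (\<alpha> n k \<omega>) + P s \<omega> \<bullet> metric_rate (K n 0) (\<alpha> n k \<omega>)
          - min_cost V A K n (P s \<omega>))) \<partial>M)"
    using P integral_frame_cost[OF V] unfolding adapted_prices_def by (intro sum.cong refl) blast
  finally show "(\<integral>\<omega>. frames_cost V P n T \<omega> \<partial>M) = \<dots>" .
qed

lemma frames_cost_nonneg:
  assumes V: "0 \<le> V" and P: "adapted_prices P"
  shows "0 \<le> (\<integral>\<omega>. frames_cost V P n T \<omega> \<partial>M)"
  unfolding integral_frames_cost(2)[OF assms]
proof (intro sum_nonneg integral_nonneg_AE AE_I2)
  fix k s \<omega> assume "\<omega> \<in> space M"
  then have "\<alpha> n k \<omega> \<in> space (A n)" by (rule action_mem)
  then show "0 \<le> indicator (starts n k s) \<omega> * (mean_length (K n 0) (\<alpha> n k \<omega>) *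
        (V * penalty_rate (K n 0) (\<alpha> n k \<omega>) + P s \<omega> \<bullet> metric_rate (K n 0) (\<alpha> n k \<omega>)
          - min_cost V A K n (P s \<omega>)))"
    using min_cost_le[OF _ V] mean_length_ge_1[of "\<alpha> n k \<omega>" n 0] by (intro mult_nonneg_nonneg) auto
qed

lemma frames_cost_eq_0:
  assumes V: "0 \<le> V" and P: "adapted_prices P"
    and greedy: "\<And>\<omega> k. \<omega> \<in> space M \<Longrightarrow> is_arg_min
      (\<lambda>a. V * penalty_rate (K n 0) a + P (\<tau> n k \<omega>) \<omega> \<bullet> metric_rate (K n 0) a)
      (\<lambda>a. a \<in> space (A n)) (\<alpha> n k \<omega>)"
  shows "(\<integral>\<omega>. frames_cost V P n T \<omega> \<partial>M) = 0"
proof -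
  have "(\<integral>\<omega>. indicator (starts n k s) \<omega> * (mean_length (K n 0) (\<alpha> n k \<omega>) *
        (V * penalty_rate (K n 0) (\<alpha> n k \<omega>) + P s \<omega> \<bullet> metric_rate (K n 0) (\<alpha> n k \<omega>)
          - min_cost V A K n (P s \<omega>))) \<partial>M) = (\<integral>\<omega>. 0 \<partial>M)" for k s
    using min_cost_arg_min[OF greedy]
    by (intro Bochner_Integration.integral_cong refl) (auto split: split_indicator)
  then show ?thesis unfolding integral_frames_cost(2)[OF V P] by simp
qed

end

lemma norm_sq_eq_sum: "(norm q)\<^sup>2 = (\<Sum>l\<in>UNIV. (q $ l)\<^sup>2)" for q :: "real ^ 'l::finite"
  by (simp add: norm_vec_def L2_set_def sum_nonneg)

section \<open>The performance of an arbitrary feasible decision sequence\<close>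

context bounded_decision_sequence
begin

abbreviation external_mean :: "'l \<Rightarrow> real" where
  "external_mean l \<equiv> \<integral>x. x $ l \<partial>D"

lemma penalty_expectation: "integrable M (y n t)" "\<bar>\<integral>\<omega>. y n t \<omega> \<partial>M\<bar> \<le> ymax"
proof -
  have bnd: "AE \<omega> in M. \<bar>y n t \<omega>\<bar> \<le> ymax" using AE_slot_bounds by (auto elim: eventually_mono)
  show int: "integrable M (y n t)"
    using bnd by (intro integrable_const_bound[where B = ymax]) auto
  have "(\<integral>\<omega>. \<bar>y n t \<omega>\<bar> \<partial>M) \<le> (\<integral>\<omega>. ymax \<partial>M)"
    using int bnd by (intro integral_mono_AE) auto
  then show "\<bar>\<integral>\<omega>. y n t \<omega> \<partial>M\<bar> \<le> ymax"
    by (intro order_trans[OF integral_abs_bound]) (simp add: prob_space)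
qed

lemma integrable_metric: "integrable M (\<lambda>\<omega>. z n t \<omega> $ l)"
  using AE_slot_bounds by (intro integrable_const_bound[where B = zmax]) (auto elim: eventually_mono)

lemma integrable_price_metric:
  assumes "adapted_prices P"
  shows "integrable M (\<lambda>\<omega>. P s \<omega> \<bullet> z n t \<omega>)"
proof -
  obtain b where b: "AE \<omega> in M. \<forall>l. \<bar>P s \<omega> $ l\<bar> \<le> b" and [measurable]: "P s \<in> borel_measurable M"
    using assms measurable_F_M unfolding adapted_prices_def by blast
  have "integrable M (\<lambda>\<omega>. P s \<omega> $ l * z n t \<omega> $ l)" for l
  proof (rule integrable_const_bound[where B = "b * zmax"])
    show "AE \<omega> in M. norm (P s \<omega> $ l * z n t \<omega> $ l) \<le> b * zmax"
      using b AE_slot_bounds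
    proof eventually_elim
      case (elim \<omega>)
      have "0 \<le> b" using elim(1) by (meson abs_ge_zero order_trans)
      with elim show ?case by (simp add: abs_mult mult_mono)
    qed
  qed measurable
  then show ?thesis by (simp add: inner_vec_def)
qed

lemma integrable_price_sq:
  assumes "adapted_prices P"
  shows "integrable M (\<lambda>\<omega>. P s \<omega> $ l)" "integrable M (\<lambda>\<omega>. (P s \<omega> $ l)\<^sup>2)"
    "integrable M (\<lambda>\<omega>. (norm (P s \<omega>))\<^sup>2)"
proof -
  obtain b where b: "AE \<omega> in M. \<forall>l. \<bar>P s \<omega> $ l\<bar> \<le> b" and [measurable]: "P s \<in> borel_measurable M"
    using assms measurable_F_M unfolding adapted_prices_def by blast
  have b_l: "AE \<omega> in M. \<bar>P s \<omega> $ l\<bar> \<le> b" for l using b by (auto elim: eventually_mono)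
  show "integrable M (\<lambda>\<omega>. P s \<omega> $ l)"
    using b_l[of l] by (intro integrable_const_bound[where B = b]) auto
  have sq: "integrable M (\<lambda>\<omega>. (P s \<omega> $ l)\<^sup>2)" for l
  proof (rule integrable_const_bound[where B = "b\<^sup>2"])
    show "AE \<omega> in M. norm ((P s \<omega> $ l)\<^sup>2) \<le> b\<^sup>2"
      using b_l[of l]
    proof eventually_elim
      case (elim \<omega>)
      then have "\<bar>P s \<omega> $ l\<bar>\<^sup>2 \<le> b\<^sup>2" by (intro power_mono) auto
      then show ?case by simp
    qed
  qed measurable
  then show "integrable M (\<lambda>\<omega>. (P s \<omega> $ l)\<^sup>2)" .
  show "integrable M (\<lambda>\<omega>. (norm (P s \<omega>))\<^sup>2)"
    using sq by (simp add: norm_sq_eq_sum)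
qed

lemma integrable_min_cost:
  assumes V: "0 \<le> V" and P: "adapted_prices P"
  shows "integrable M (\<lambda>\<omega>. min_cost V A K n (P s \<omega>))"
proof -
  have [measurable]: "P s \<in> borel_measurable M"
    using P measurable_F_M unfolding adapted_prices_def by blast
  have meas: "(\<lambda>\<omega>. min_cost V A K n (P s \<omega>)) \<in> borel_measurable M"
    by (rule measurable_compose[OF _ measurable_min_cost[OF V]]) simp
  have int: "integrable M (\<lambda>\<omega>. V * ymax + zmax * l1_norm (P s \<omega>))"
    unfolding l1_norm_def using integrable_price_sq(1)[OF P] by simp
  show ?thesis
    using min_cost_bound[OF V, of n "P s _"]
    by (intro Bochner_Integration.integrable_bound[OF int meas] AE_I2)
      (auto intro: order_trans[OF _ abs_ge_self])
qed

lemma integrable_frozen_cost: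
  assumes "0 \<le> V" "adapted_prices P"
  shows "integrable M (frozen_cost V P n t s)"
  unfolding frozen_cost_def[abs_def]
  using penalty_expectation(1) integrable_price_metric[OF assms(2)] integrable_min_cost[OF assms] by simp

lemma constant_prices_adapted: "adapted_prices (\<lambda>_ _. q)"
  unfolding adapted_prices_def using component_le_norm_cart[of q] by (auto intro!: exI[of _ "norm q"])

text \<open>
  No policy, however it depends on the past, beats the best rate at constant prices \<open>q\<close> by more than the cost of
  the slots that complete the frame in progress at time \<open>T\<close>.
\<close>
lemma cost_at_fixed_prices:
  assumes V: "0 \<le> V"
  shows "real T * min_cost V A K n q - 2 * (V * ymax + zmax * l1_norm q) * B \<le>
    (\<Sum>t<T. V * (\<integral>\<omega>. y n t \<omega> \<partial>M) + (\<Sum>l\<in>UNIV. q $ l * (\<integral>\<omega>. z n t \<omega> $ l \<partial>M)))"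
proof -
  let ?P = "\<lambda>(_ :: nat) (_ :: 'w). q"
  let ?b = "2 * (V * ymax + zmax * l1_norm q)"
  note P = constant_prices_adapted[of q]
  have b: "0 \<le> ?b" using V ymax_nonneg zmax_nonneg l1_norm_nonneg[of q] by simp
  have freeze: "AE \<omega> in M. \<bar>(\<Sum>t<T. frozen_cost V ?P n t t \<omega>) - frames_cost V ?P n T \<omega>\<bar> \<le>
      ?b * overshoot n T \<omega>"
    using AE_freeze_prices[OF V, of 0 ?P n T] by simp
  have "(\<integral>\<omega>. frames_cost V ?P n T \<omega> - ?b * overshoot n T \<omega> \<partial>M) \<le>
      (\<integral>\<omega>. (\<Sum>t<T. frozen_cost V ?P n t t \<omega>) \<partial>M)"
    using freeze integral_frames_cost(1)[OF V P] overshoot_expectation(1) integrable_frozen_cost[OF V P]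
    by (intro integral_mono_AE) (auto elim: eventually_mono)
  then have "(\<integral>\<omega>. frames_cost V ?P n T \<omega> \<partial>M) - ?b * (\<integral>\<omega>. overshoot n T \<omega> \<partial>M) \<le>
      (\<Sum>t<T. \<integral>\<omega>. frozen_cost V ?P n t t \<omega> \<partial>M)"
    using integral_frames_cost(1)[OF V P] overshoot_expectation(1) integrable_frozen_cost[OF V P] by simp
  moreover have "?b * (\<integral>\<omega>. overshoot n T \<omega> \<partial>M) \<le> ?b * B"
    using b by (intro mult_left_mono overshoot_expectation(2))
  moreover have "(\<integral>\<omega>. frozen_cost V ?P n t t \<omega> \<partial>M) = V * (\<integral>\<omega>. y n t \<omega> \<partial>M) +
      (\<Sum>l\<in>UNIV. q $ l * (\<integral>\<omega>. z n t \<omega> $ l \<partial>M)) - min_cost V A K n q" for t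
    unfolding frozen_cost_def inner_vec_def
    using penalty_expectation(1) integrable_metric by (simp add: prob_space)
  ultimately show ?thesis
    using frames_cost_nonneg[OF V P, of n T] by (simp add: sum_subtractf)
qed

text \<open>
  Weak duality: charging nonnegative prices for the metrics and refunding them at the rate
  allowed by the constraints can only make a feasible sequence cheaper. The bound for
  a finite horizon is divided by the horizon, and the limits superior are replaced by strict upper bounds so that
  penalty and metrics can be bounded at a common time.
\<close>
lemma min_cost_le_feasible:
  assumes V: "0 \<le> V" and q: "\<And>l. 0 \<le> q $ l"
    and feasible: "constraints_satisfied D M z" and r: "avg_penalty M y < ereal r"
  shows "(\<Sum>n\<in>UNIV. min_cost V A K n q) \<le> V * r + (\<Sum>l\<in>UNIV. q $ l * external_mean l)"
proof (rule field_le_epsilon)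
  fix \<epsilon> :: real assume "0 < \<epsilon>"
  \<comment> \<open>Slack in each constraint whose total price stays below \<open>\<epsilon>\<close>; the \<open>1\<close> covers \<open>q = 0\<close>.\<close>
  define e where "e = \<epsilon> / (1 + (\<Sum>l\<in>UNIV. q $ l))"
  have q1: "0 < 1 + (\<Sum>l\<in>UNIV. q $ l)" using q by (intro add_pos_nonneg sum_nonneg) auto
  then have e: "0 < e" using \<open>0 < \<epsilon>\<close> by (simp add: e_def)
  let ?a = "\<lambda>T. 1 / real T * (\<Sum>t<T. \<Sum>n\<in>UNIV. \<integral>\<omega>. y n t \<omega> \<partial>M)"
  let ?b = "\<lambda>l T. 1 / real T * (\<Sum>t<T. \<Sum>n\<in>UNIV. \<integral>\<omega>. z n t \<omega> $ l \<partial>M)"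
  let ?C = "\<Sum>n\<in>(UNIV :: 'n set). 2 * (V * ymax + zmax * l1_norm q) * B"
  let ?m = "\<Sum>n\<in>UNIV. min_cost V A K n q"
  have ev_a: "\<forall>\<^sub>F T in sequentially. ?a T < r"
    using Limsup_lessD[OF r[unfolded avg_penalty_def]] by simp
  have "\<forall>\<^sub>F T in sequentially. ?b l T < external_mean l + e" for l
  proof -
    have "avg_metric M z l \<le> ereal (external_mean l)"
      using feasible by (simp add: constraints_satisfied_def)
    also have "\<dots> < ereal (external_mean l + e)" using e by simp
    finally show ?thesis
      unfolding avg_metric_def using Limsup_lessD by fastforce
  qed
  then have ev_b: "\<forall>\<^sub>F T in sequentially. \<forall>l. ?b l T < external_mean l + e"
    by (rule eventually_all_finite)
  have bound: "\<forall>\<^sub>F T in sequentially. ?m - ?C / real T \<le>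
      V * r + (\<Sum>l\<in>UNIV. q $ l * (external_mean l + e))"
    using ev_a ev_b eventually_gt_at_top[of 0]
  proof eventually_elim
    case (elim T)
    have "real T * ?m - ?C \<le> (\<Sum>n\<in>UNIV. \<Sum>t<T. V * (\<integral>\<omega>. y n t \<omega> \<partial>M) +
        (\<Sum>l\<in>UNIV. q $ l * (\<integral>\<omega>. z n t \<omega> $ l \<partial>M)))"
      unfolding sum_distrib_left sum_subtractf[symmetric]
      by (intro sum_mono cost_at_fixed_prices[OF V])
    also have "\<dots> = V * (\<Sum>t<T. \<Sum>n\<in>UNIV. \<integral>\<omega>. y n t \<omega> \<partial>M) +
        (\<Sum>l\<in>UNIV. q $ l * (\<Sum>t<T. \<Sum>n\<in>UNIV. \<integral>\<omega>. z n t \<omega> $ l \<partial>M))"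
    proof -
      have "(\<Sum>n\<in>UNIV. \<Sum>t<T. \<Sum>l\<in>UNIV. q $ l * (\<integral>\<omega>. z n t \<omega> $ l \<partial>M)) =
          (\<Sum>l\<in>UNIV. q $ l * (\<Sum>t<T. \<Sum>n\<in>UNIV. \<integral>\<omega>. z n t \<omega> $ l \<partial>M))"
        unfolding sum_distrib_left
        by (subst sum.swap[of _ "{..<T}" UNIV], subst sum.swap[of _ UNIV UNIV],
            intro sum.cong refl sum.swap)
      moreover have "(\<Sum>n\<in>UNIV. \<Sum>t<T. V * (\<integral>\<omega>. y n t \<omega> \<partial>M)) =
          V * (\<Sum>t<T. \<Sum>n\<in>UNIV. \<integral>\<omega>. y n t \<omega> \<partial>M)"
        unfolding sum_distrib_left by (rule sum.swap)
      ultimately show ?thesis by (simp add: sum.distrib)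
    qed
    also have "\<dots> = real T * (V * ?a T + (\<Sum>l\<in>UNIV. q $ l * ?b l T))"
      using elim(3) by (simp add: distrib_left sum_distrib_left mult.assoc mult.left_commute)
    also have "\<dots> \<le> real T * (V * r + (\<Sum>l\<in>UNIV. q $ l * (external_mean l + e)))"
      using elim V q
      by (intro mult_left_mono add_mono sum_mono) (auto intro: less_imp_le)
    finally show ?case using elim(3) by (simp add: field_simps)
  qed
  have "(\<lambda>T. ?m - ?C / real T) \<longlonglongrightarrow> ?m - 0"
    by (intro tendsto_intros lim_const_over_n)
  from tendsto_upperbound[OF this bound]
  have "?m \<le> V * r + (\<Sum>l\<in>UNIV. q $ l * (external_mean l + e))"
    by simp
  also have "\<dots> = V * r + (\<Sum>l\<in>UNIV. q $ l * external_mean l) + e * (\<Sum>l\<in>UNIV. q $ l)"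
    by (simp add: distrib_left sum.distrib sum_distrib_left mult.commute)
  also have "e * (\<Sum>l\<in>UNIV. q $ l) \<le> \<epsilon>"
    using q1 \<open>0 < \<epsilon>\<close> by (simp add: e_def field_simps)
  finally show "?m \<le> V * r + (\<Sum>l\<in>UNIV. q $ l * external_mean l) + \<epsilon>" by simp
qed

section \<open>The virtual queues\<close>

abbreviation Q :: "nat \<Rightarrow> 'w \<Rightarrow> real ^ 'l" where
  "Q \<equiv> queue z d"

lemma net_input_bound_nonneg: "0 \<le> (real CARD('n) * zmax + dmax)"
  using zmax_nonneg dmax_nonneg by simp

lemma queue_nonneg: "0 \<le> Q t \<omega> $ l"
  by (cases t) auto

lemma measurable_F_mono: "f \<in> borel_measurable (F s) \<Longrightarrow> s \<le> t \<Longrightarrow> f \<in> borel_measurable (F t)"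
  by (rule measurable_from_subalg[of _ "F s"]) (auto simp: subalgebra_def space_F sets_F_mono)

lemma measurable_queue: "Q t \<in> borel_measurable (F t)"
proof (induction t)
  case 0
  then show ?case by (simp add: measurable_cong[of _ "\<lambda>\<omega>. Q 0 \<omega>" "\<lambda>_. 0"])
next
  case (Suc t)
  have [measurable]: "Q t \<in> borel_measurable (F (Suc t))" using Suc by (rule measurable_F_mono) simp
  note penalty_adapted[measurable] metric_adapted[measurable] external_adapted[measurable]
  have "(\<lambda>\<omega>. \<chi> l. max (Q t \<omega> $ l + (\<Sum>n\<in>UNIV. z n t \<omega> $ l) - d t \<omega> $ l) 0)
      \<in> borel_measurable (F (Suc t))"
    by measurable
  then show ?case by (simp cong: measurable_cong)
qed

lemma AE_net_input_bound:
  "AE \<omega> in M. \<forall>t l. \<bar>(\<Sum>n\<in>UNIV. z n t \<omega> $ l) - d t \<omega> $ l\<bar> \<le> (real CARD('n) * zmax + dmax)"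
  using AE_slot_bounds AE_external_bound
proof eventually_elim
  case (elim \<omega>)
  show ?case
  proof (intro allI)
    fix t l
    have "\<bar>\<Sum>n\<in>UNIV. z n t \<omega> $ l\<bar> \<le> (\<Sum>n\<in>(UNIV :: 'n set). zmax)"
      using elim(1) by (intro order_trans[OF sum_abs] sum_mono) auto
    moreover have "\<bar>d t \<omega> $ l\<bar> \<le> dmax" using elim(2) by simp
    ultimately show "\<bar>(\<Sum>n\<in>UNIV. z n t \<omega> $ l) - d t \<omega> $ l\<bar> \<le> (real CARD('n) * zmax + dmax)" by simp
  qed
qed

lemma AE_queue_lipschitz:
  "AE \<omega> in M. \<forall>s s' l. s \<le> s' \<longrightarrow> \<bar>Q s \<omega> $ l - Q s' \<omega> $ l\<bar> \<le> (real CARD('n) * zmax + dmax) * real (s' - s)"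
  using AE_net_input_bound
proof eventually_elim
  case (elim \<omega>)
  have step: "\<bar>Q t \<omega> $ l - Q (Suc t) \<omega> $ l\<bar> \<le> (real CARD('n) * zmax + dmax)" for t l
    using elim[rule_format, of t l] queue_nonneg[of t \<omega> l] by (simp add: max_def abs_le_iff)
  have "\<bar>Q s \<omega> $ l - Q (s + j) \<omega> $ l\<bar> \<le> (real CARD('n) * zmax + dmax) * real j" for s j l
  proof (induction j)
    case (Suc j)
    then show ?case using step[of "s + j" l] by (simp add: algebra_simps)
  qed simp
  then show ?case by (metis le_add_diff_inverse)
qed

lemma queue_adapted_prices: "adapted_prices Q"
  unfolding adapted_prices_def
proof (intro allI conjI exI)
  fix s
  show "Q s \<in> borel_measurable (F s)" by (rule measurable_queue)
  show "AE \<omega> in M. \<forall>l. \<bar>Q s \<omega> $ l\<bar> \<le> (real CARD('n) * zmax + dmax) * real s"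
    using AE_queue_lipschitz
  proof eventually_elim
    case (elim \<omega>)
    then show ?case using elim[rule_format, of 0 s] by simp
  qed
qed

lemma external_integrable: "integrable M (\<lambda>\<omega>. d t \<omega> $ l)"
  using AE_external_bound
  by (intro integrable_const_bound[where B = dmax]) (auto elim: eventually_mono)

lemma external_expectation: "(\<integral>\<omega>. d t \<omega> $ l \<partial>M) = external_mean l"
  unfolding external_distr[of t, symmetric] by (subst integral_distr) auto

lemma queue_external_uncorrelated:
  "integrable M (\<lambda>\<omega>. Q t \<omega> $ l * d t \<omega> $ l)"
  "(\<integral>\<omega>. Q t \<omega> $ l * d t \<omega> $ l \<partial>M) = (\<integral>\<omega>. Q t \<omega> $ l \<partial>M) * external_mean l"
proof -
  have QF: "(\<lambda>\<omega>. Q t \<omega> $ l) \<in> borel_measurable (F t)" using measurable_queue[of t] by measurable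
  have dM: "(\<lambda>\<omega>. d t \<omega> $ l) \<in> borel_measurable M" by measurable
  let ?\<D> = "{d t -` S \<inter> space M | S. S \<in> sets borel}"
  have ind: "indep_var borel (\<lambda>\<omega>. Q t \<omega> $ l) borel (\<lambda>\<omega>. d t \<omega> $ l)"
    unfolding indep_var_eq
  proof (intro conjI)
    have sa: "sigma_algebra (space M) (sets (F t))"
      using sets.sigma_algebra_axioms[of "F t"] by (simp add: space_F)
    have "sigma_sets (space M) {(\<lambda>\<omega>. Q t \<omega> $ l) -` A \<inter> space M |A. A \<in> sets borel} \<subseteq> sets (F t)"
      using measurable_sets[OF QF] by (intro sigma_algebra.sigma_sets_subset[OF sa]) (auto simp: space_F)
    moreover have "sigma_sets (space M) {(\<lambda>\<omega>. d t \<omega> $ l) -` A \<inter> space M |A. A \<in> sets borel} \<subseteq> ?\<D>"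
    proof
      fix X assume "X \<in> sigma_sets (space M) {(\<lambda>\<omega>. d t \<omega> $ l) -` A \<inter> space M |A. A \<in> sets borel}"
      also have "\<dots> = {(\<lambda>\<omega>. d t \<omega> $ l) -` A \<inter> space M |A. A \<in> sets borel}"
        using sigma_sets_vimage_commute[of "\<lambda>\<omega>. d t \<omega> $ l" "space M" UNIV "sets borel"]
          sets.sigma_sets_eq[of "borel :: real measure"] by auto
      finally obtain A where A: "A \<in> sets borel" "X = (\<lambda>\<omega>. d t \<omega> $ l) -` A \<inter> space M" by auto
      then have "X = d t -` ((\<lambda>v. v $ l) -` A) \<inter> space M" by auto
      moreover have "(\<lambda>v :: real ^ 'l. v $ l) -` A \<in> sets borel"
        using measurable_sets_borel[of "\<lambda>v :: real ^ 'l. v $ l" borel A] A(1) by simp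
      ultimately show "X \<in> ?\<D>" by blast
    qed
    ultimately show "indep_set (sigma_sets (space M) {(\<lambda>\<omega>. Q t \<omega> $ l) -` A \<inter> space M |A. A \<in> sets borel})
        (sigma_sets (space M) {(\<lambda>\<omega>. d t \<omega> $ l) -` A \<inter> space M |A. A \<in> sets borel})"
      using external_indep[of t] unfolding indep_set_def
      by (elim indep_sets_mono_sets) (auto split: bool.split)
  qed (use QF measurable_F_M dM in auto)
  from indep_var_lebesgue_integral[OF ind integrable_price_sq(1)[OF queue_adapted_prices] external_integrable]
    indep_var_integrable[OF ind integrable_price_sq(1)[OF queue_adapted_prices] external_integrable]
  show "integrable M (\<lambda>\<omega>. Q t \<omega> $ l * d t \<omega> $ l)"
    "(\<integral>\<omega>. Q t \<omega> $ l * d t \<omega> $ l \<partial>M) = (\<integral>\<omega>. Q t \<omega> $ l \<partial>M) * external_mean l"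
    by (simp_all add: external_expectation)
qed

lemma integrable_queue_external: "integrable M (\<lambda>\<omega>. Q t \<omega> \<bullet> d t \<omega>)"
  unfolding inner_vec_def using queue_external_uncorrelated(1) by simp

text \<open>
  The usual quadratic drift bound: truncation at zero does not increase the square, and the net input of a slot
  is at most \<open>N zmax + dmax\<close> in each component.
\<close>
lemma AE_queue_drift:
  "AE \<omega> in M. (norm (Q T \<omega>))\<^sup>2 \<le> real CARD('l) * (real CARD('n) * zmax + dmax)\<^sup>2 * real T +
    2 * (\<Sum>t<T. (\<Sum>n\<in>UNIV. Q t \<omega> \<bullet> z n t \<omega>) - Q t \<omega> \<bullet> d t \<omega>)"
  using AE_net_input_bound
proof eventually_elim
  case (elim \<omega>)
  let ?x = "\<lambda>t l. (\<Sum>n\<in>UNIV. z n t \<omega> $ l) - d t \<omega> $ l"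
  have comp: "(Q (Suc t) \<omega> $ l)\<^sup>2 \<le> (Q t \<omega> $ l)\<^sup>2 + (real CARD('n) * zmax + dmax)\<^sup>2 + 2 * (Q t \<omega> $ l * ?x t l)" for t l
  proof -
    have "(Q (Suc t) \<omega> $ l)\<^sup>2 \<le> (Q t \<omega> $ l + ?x t l)\<^sup>2"
      by (simp add: max_def algebra_simps)
    also have "\<dots> = (Q t \<omega> $ l)\<^sup>2 + (?x t l)\<^sup>2 + 2 * (Q t \<omega> $ l * ?x t l)"
      by (simp add: power2_sum)
    also have "(?x t l)\<^sup>2 \<le> (real CARD('n) * zmax + dmax)\<^sup>2"
      using elim[rule_format, of t l] by (metis abs_ge_zero power2_abs power_mono)
    finally show ?thesis by simp
  qed
  have inner: "(\<Sum>l\<in>UNIV. Q t \<omega> $ l * ?x t l) = (\<Sum>n\<in>UNIV. Q t \<omega> \<bullet> z n t \<omega>) - Q t \<omega> \<bullet> d t \<omega>" for t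
    unfolding inner_vec_def
    by (subst sum.swap) (simp add: right_diff_distrib sum_subtractf sum_distrib_left)
  show ?case
  proof (induction T)
    case 0
    then show ?case by (simp add: norm_sq_eq_sum)
  next
    case (Suc T)
    have "(norm (Q (Suc T) \<omega>))\<^sup>2 \<le>
        (\<Sum>l\<in>UNIV. (Q T \<omega> $ l)\<^sup>2 + (real CARD('n) * zmax + dmax)\<^sup>2 + 2 * (Q T \<omega> $ l * ?x T l))"
      unfolding norm_sq_eq_sum by (intro sum_mono comp)
    also have "\<dots> = (norm (Q T \<omega>))\<^sup>2 + real CARD('l) * (real CARD('n) * zmax + dmax)\<^sup>2 +
        2 * ((\<Sum>n\<in>UNIV. Q T \<omega> \<bullet> z n T \<omega>) - Q T \<omega> \<bullet> d T \<omega>)"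
      by (simp add: sum.distrib norm_sq_eq_sum sum_distrib_left[symmetric] inner)
    finally show ?case using Suc by (simp add: algebra_simps)
  qed
qed

lemma queue_ge_net_input:
  "(\<Sum>t<T. (\<Sum>n\<in>UNIV. z n t \<omega> $ l) - d t \<omega> $ l) \<le> Q T \<omega> $ l"
  by (induction T) auto

end

section \<open>The performance of the algorithm\<close>

context bounded_decision_sequence
begin

lemma avg_penalty_le_ymax: "avg_penalty M y \<le> ereal (real CARD('n) * ymax)"
  unfolding avg_penalty_def
proof (rule Limsup_bounded)
  show "\<forall>\<^sub>F T in sequentially. ereal (1 / real T * (\<Sum>t<T. \<Sum>n\<in>UNIV. \<integral>\<omega>. y n t \<omega> \<partial>M)) \<le>
      ereal (real CARD('n) * ymax)"
    using eventually_gt_at_top[of 0]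
  proof eventually_elim
    case (elim T)
    have "(\<Sum>t<T. \<Sum>n\<in>UNIV. \<integral>\<omega>. y n t \<omega> \<partial>M) \<le> (\<Sum>t<T. \<Sum>n\<in>(UNIV :: 'n set). ymax)"
      using penalty_expectation(2) by (intro sum_mono) (auto simp: abs_le_iff)
    with elim show ?case by (simp add: field_simps)
  qed
qed

text \<open>
  The loss from acting on the prices at the start of the frame instead of the current ones. The first
  term is the price drift inside frames; the others come from the overshoot at time \<open>T\<close>, where \<open>\<delta>\<close> trades a
  fraction of \<open>E \<bar>P T\<bar>\<^sup>2\<close> against a constant.
\<close>
lemma greedy_cost:
  assumes V: "0 \<le> V" and P: "adapted_prices P" and c: "0 \<le> c" and \<delta>: "0 < \<delta>"
    and lip: "AE \<omega> in M. \<forall>s s' l. s \<le> s' \<longrightarrow> \<bar>P s \<omega> $ l - P s' \<omega> $ l\<bar> \<le> c * real (s' - s)"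
    and greedy: "\<And>\<omega> k. \<omega> \<in> space M \<Longrightarrow> is_arg_min
      (\<lambda>a. V * penalty_rate (K n 0) a + P (\<tau> n k \<omega>) \<omega> \<bullet> metric_rate (K n 0) a)
      (\<lambda>a. a \<in> space (A n)) (\<alpha> n k \<omega>)"
  shows "(\<Sum>t<T. \<integral>\<omega>. frozen_cost V P n t t \<omega> \<partial>M) \<le>
    2 * zmax * (real CARD('l) * c) * B * real T +
    (2 * V * ymax + real CARD('l) * (zmax\<^sup>2 / \<delta>)) * B +
    \<delta> * (\<integral>\<omega>. (norm (P T \<omega>))\<^sup>2 \<partial>M)"
proof -
  let ?c = "2 * zmax * (real CARD('l) * c)"
  let ?e = "2 * V * ymax + real CARD('l) * (zmax\<^sup>2 / \<delta>)"
  let ?R = "overshoot n T"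
  have c0: "0 \<le> ?c" using zmax_nonneg c by simp
  have e0: "0 \<le> ?e" using V ymax_nonneg \<delta> by simp
  \<comment> \<open>Young's inequality, to decouple the prices at time \<open>T\<close> from the overshoot.\<close>
  have young: "2 * zmax * \<bar>q $ l\<bar> * R \<le> \<delta> * (q $ l)\<^sup>2 + zmax\<^sup>2 / \<delta> * R\<^sup>2" for q :: "real ^ 'l" and l R
  proof -
    have "0 \<le> (\<delta> * \<bar>q $ l\<bar> - zmax * R)\<^sup>2 / \<delta>" using \<delta> by simp
    also have "\<dots> = \<delta> * (q $ l)\<^sup>2 + zmax\<^sup>2 / \<delta> * R\<^sup>2 - 2 * zmax * \<bar>q $ l\<bar> * R"
      using \<delta> by (simp add: power2_diff power_mult_distrib field_simps power2_eq_square[of \<delta>])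
    finally show ?thesis by simp
  qed
  have over: "2 * (V * ymax + zmax * l1_norm q) * ?R \<omega> \<le> ?e * (?R \<omega>)\<^sup>2 + \<delta> * (norm q)\<^sup>2"
    for q :: "real ^ 'l" and \<omega>
  proof -
    have "2 * zmax * l1_norm q * ?R \<omega> = (\<Sum>l\<in>UNIV. 2 * zmax * \<bar>q $ l\<bar> * ?R \<omega>)"
      by (simp add: l1_norm_def sum_distrib_left sum_distrib_right)
    also have "\<dots> \<le> (\<Sum>l\<in>UNIV. \<delta> * (q $ l)\<^sup>2 + zmax\<^sup>2 / \<delta> * (?R \<omega>)\<^sup>2)"
      by (intro sum_mono young)
    also have "\<dots> = \<delta> * (norm q)\<^sup>2 + real CARD('l) * (zmax\<^sup>2 / \<delta>) * (?R \<omega>)\<^sup>2"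
      by (simp add: sum.distrib norm_sq_eq_sum sum_distrib_left)
    finally have "2 * zmax * l1_norm q * ?R \<omega> \<le> \<dots>" .
    moreover have "2 * V * ymax * ?R \<omega> \<le> 2 * V * ymax * (?R \<omega>)\<^sup>2"
      using V ymax_nonneg by (intro mult_left_mono overshoot_le_sq) auto
    ultimately show ?thesis by (simp add: algebra_simps)
  qed
  note int = integral_frames_cost(1)[OF V P] sq_lengths_expectation(1) overshoot_sq_expectation(1)
    integrable_price_sq(3)[OF P] integrable_frozen_cost[OF V P]
  have bound: "AE \<omega> in M. (\<Sum>t<T. frozen_cost V P n t t \<omega>) \<le> frames_cost V P n T \<omega> +
      ?c * sq_lengths n T \<omega> + ?e * (?R \<omega>)\<^sup>2 + \<delta> * (norm (P T \<omega>))\<^sup>2"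
    using AE_freeze_prices[OF V c lip, where n = n and T = T]
  proof eventually_elim
    case (elim \<omega>)
    then show ?case using over[of "P T \<omega>" \<omega>] by linarith
  qed
  have "(\<Sum>t<T. \<integral>\<omega>. frozen_cost V P n t t \<omega> \<partial>M) = (\<integral>\<omega>. (\<Sum>t<T. frozen_cost V P n t t \<omega>) \<partial>M)"
    using int by simp
  also have "\<dots> \<le> (\<integral>\<omega>. frames_cost V P n T \<omega> +
      ?c * sq_lengths n T \<omega> + ?e * (?R \<omega>)\<^sup>2 + \<delta> * (norm (P T \<omega>))\<^sup>2 \<partial>M)"
    using int bound by (intro integral_mono_AE) auto
  also have "\<dots> = (\<integral>\<omega>. frames_cost V P n T \<omega> \<partial>M) + ?c * (\<integral>\<omega>. sq_lengths n T \<omega> \<partial>M) +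
      ?e * (\<integral>\<omega>. (?R \<omega>)\<^sup>2 \<partial>M) + \<delta> * (\<integral>\<omega>. (norm (P T \<omega>))\<^sup>2 \<partial>M)"
    using int by simp
  also have "(\<integral>\<omega>. frames_cost V P n T \<omega> \<partial>M) = 0"
    by (rule frames_cost_eq_0[OF V P greedy])
  also have "?c * (\<integral>\<omega>. sq_lengths n T \<omega> \<partial>M) \<le> ?c * (B * real T)"
    using c0 by (intro mult_left_mono sq_lengths_expectation(2))
  also have "?e * (\<integral>\<omega>. (?R \<omega>)\<^sup>2 \<partial>M) \<le> ?e * B"
    using e0 by (intro mult_left_mono overshoot_sq_expectation(2))
  finally show ?thesis by (simp add: mult.assoc)
qed

lemma queue_greedy:
  assumes "proposed_algorithm V A K M \<tau> \<alpha> z d" "\<omega> \<in> space M"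
  shows "is_arg_min (\<lambda>a. V * penalty_rate (K n 0) a + Q (\<tau> n k \<omega>) \<omega> \<bullet> metric_rate (K n 0) a)
      (\<lambda>a. a \<in> space (A n)) (\<alpha> n k \<omega>)"
  using assms unfolding proposed_algorithm_def Let_def by blast

text \<open>
  The drift bound contains \<open>Q[t] \<bullet> z\<^sup>n[t]\<close> and \<open>- Q[t] \<bullet> d[t]\<close>. Adding \<open>V y\<^sup>n[t]\<close> to the former and subtracting
  \<open>m\<^sub>n(Q[t])\<close> gives the cost bounded by \<open>greedy_cost\<close>; the subtracted terms are returned to the latter, and the
  assumption on \<open>r\<close>, used at the random prices \<open>Q[t]\<close>, bounds what remains by \<open>V r\<close>.
\<close>
lemma drift_plus_penalty:
  assumes V: "0 \<le> V" and algorithm: "proposed_algorithm V A K M \<tau> \<alpha> z d"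
    and r: "\<And>q. (\<And>l. 0 \<le> q $ l) \<Longrightarrow>
      (\<Sum>n\<in>UNIV. min_cost V A K n q) \<le> V * r + (\<Sum>l\<in>UNIV. q $ l * external_mean l)"
  obtains C where "\<And>T. V * (\<Sum>t<T. \<Sum>n\<in>UNIV. \<integral>\<omega>. y n t \<omega> \<partial>M) + (\<integral>\<omega>. (norm (Q T \<omega>))\<^sup>2 \<partial>M) / 4 \<le>
    (V * r + real CARD('n) * (2 * zmax * (real CARD('l) * (real CARD('n) * zmax + dmax)) * B) +
      (real CARD('n) * zmax + dmax)\<^sup>2 * real CARD('l) / 2) * real T + C"
proof
  fix T
  let ?N = "real CARD('n)" and ?L = "real CARD('l)" and ?c = "real CARD('n) * zmax + dmax"
  \<comment> \<open>Each of the \<open>N\<close> systems uses up \<open>?\<delta> * ?S\<close>, so that \<open>?S / 4\<close> of the \<open>?S / 2\<close> supplied by the drift remains.\<close>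
  let ?\<delta> = "1 / (4 * ?N)"
  let ?S = "\<integral>\<omega>. (norm (Q T \<omega>))\<^sup>2 \<partial>M"
  have N: "0 < ?N" by simp
  note P = queue_adapted_prices
  note int = integrable_price_metric[OF P] integrable_min_cost[OF V P] integrable_queue_external
    penalty_expectation(1) integrable_price_sq[OF P] queue_external_uncorrelated(1)
  have drift: "?S \<le> ?L * ?c\<^sup>2 * real T +
      2 * (\<Sum>t<T. (\<Sum>n\<in>UNIV. \<integral>\<omega>. Q t \<omega> \<bullet> z n t \<omega> \<partial>M) - (\<integral>\<omega>. Q t \<omega> \<bullet> d t \<omega> \<partial>M))"
  proof -
    have "?S \<le> (\<integral>\<omega>. ?L * ?c\<^sup>2 * real T +
        2 * (\<Sum>t<T. (\<Sum>n\<in>UNIV. Q t \<omega> \<bullet> z n t \<omega>) - Q t \<omega> \<bullet> d t \<omega>) \<partial>M)"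
      using int AE_queue_drift[of T] by (intro integral_mono_AE) auto
    then show ?thesis using int by (simp add: prob_space)
  qed
  have price: "(\<Sum>n\<in>UNIV. \<integral>\<omega>. min_cost V A K n (Q t \<omega>) \<partial>M) \<le> V * r + (\<integral>\<omega>. Q t \<omega> \<bullet> d t \<omega> \<partial>M)" for t
  proof -
    have "(\<Sum>n\<in>UNIV. \<integral>\<omega>. min_cost V A K n (Q t \<omega>) \<partial>M) = (\<integral>\<omega>. (\<Sum>n\<in>UNIV. min_cost V A K n (Q t \<omega>)) \<partial>M)"
      using int by simp
    also have "\<dots> \<le> (\<integral>\<omega>. V * r + (\<Sum>l\<in>UNIV. Q t \<omega> $ l * external_mean l) \<partial>M)"
      using int r[OF queue_nonneg] by (intro integral_mono) auto
    also have "\<dots> = V * r + (\<Sum>l\<in>UNIV. (\<integral>\<omega>. Q t \<omega> $ l \<partial>M) * external_mean l)"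
      using int by (simp add: prob_space)
    also have "(\<Sum>l\<in>UNIV. (\<integral>\<omega>. Q t \<omega> $ l \<partial>M) * external_mean l) = (\<integral>\<omega>. Q t \<omega> \<bullet> d t \<omega> \<partial>M)"
      unfolding inner_vec_def using int by (simp add: queue_external_uncorrelated(2))
    finally show ?thesis .
  qed
  have frozen: "(\<integral>\<omega>. frozen_cost V Q n t t \<omega> \<partial>M) = V * (\<integral>\<omega>. y n t \<omega> \<partial>M) +
      (\<integral>\<omega>. Q t \<omega> \<bullet> z n t \<omega> \<partial>M) - (\<integral>\<omega>. min_cost V A K n (Q t \<omega>) \<partial>M)" for n t
    unfolding frozen_cost_def using int by simp
  let ?C = "(2 * V * ymax + ?L * (zmax\<^sup>2 / ?\<delta>)) * B"
  let ?k = "2 * zmax * (?L * ?c) * B"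
  have "(\<Sum>t<T. \<integral>\<omega>. frozen_cost V Q n t t \<omega> \<partial>M) \<le> ?k * real T + ?C + ?\<delta> * ?S" for n
    using N by (intro greedy_cost[OF V P net_input_bound_nonneg _ AE_queue_lipschitz]
        queue_greedy[OF algorithm]) simp
  then have "(\<Sum>n\<in>UNIV. \<Sum>t<T. \<integral>\<omega>. frozen_cost V Q n t t \<omega> \<partial>M) \<le>
      (\<Sum>n\<in>(UNIV :: 'n set). ?k * real T + ?C + ?\<delta> * ?S)"
    by (intro sum_mono)
  also have "\<dots> = ?N * ?k * real T + ?N * ?C + ?S / 4" by (simp add: algebra_simps)
  finally have greedy: "(\<Sum>t<T. \<Sum>n\<in>UNIV. \<integral>\<omega>. frozen_cost V Q n t t \<omega> \<partial>M) \<le>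
      ?N * ?k * real T + ?N * ?C + ?S / 4"
    by (subst sum.swap)
  have "V * (\<Sum>t<T. \<Sum>n\<in>UNIV. \<integral>\<omega>. y n t \<omega> \<partial>M) +
      (\<Sum>t<T. (\<Sum>n\<in>UNIV. \<integral>\<omega>. Q t \<omega> \<bullet> z n t \<omega> \<partial>M) - (\<integral>\<omega>. Q t \<omega> \<bullet> d t \<omega> \<partial>M)) =
      (\<Sum>t<T. \<Sum>n\<in>UNIV. \<integral>\<omega>. frozen_cost V Q n t t \<omega> \<partial>M) +
      (\<Sum>t<T. (\<Sum>n\<in>UNIV. \<integral>\<omega>. min_cost V A K n (Q t \<omega>) \<partial>M) - (\<integral>\<omega>. Q t \<omega> \<bullet> d t \<omega> \<partial>M))"
    by (simp add: frozen sum.distrib sum_subtractf sum_distrib_left)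
  also have "\<dots> \<le> (?N * ?k * real T + ?N * ?C + ?S / 4) + (\<Sum>t<T. V * r)"
    using price by (intro add_mono greedy sum_mono) (simp add: algebra_simps)
  finally show "V * (\<Sum>t<T. \<Sum>n\<in>UNIV. \<integral>\<omega>. y n t \<omega> \<partial>M) + ?S / 4 \<le>
      (V * r + ?N * ?k + ?c\<^sup>2 * ?L / 2) * real T + ?N * ?C"
    using drift by (simp add: algebra_simps)
qed

lemma algorithm_penalty:
  assumes V: "0 < V" and bound: "\<And>T. V * (\<Sum>t<T. \<Sum>n\<in>UNIV. \<integral>\<omega>. y n t \<omega> \<partial>M) +
      (\<integral>\<omega>. (norm (Q T \<omega>))\<^sup>2 \<partial>M) / 4 \<le> \<kappa> * real T + C"
  shows "avg_penalty M y \<le> ereal (\<kappa> / V)"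
proof -
  let ?a = "\<lambda>T. 1 / real T * (\<Sum>t<T. \<Sum>n\<in>UNIV. \<integral>\<omega>. y n t \<omega> \<partial>M)"
  have "\<forall>\<^sub>F T in sequentially. ereal (?a T) \<le> ereal (\<kappa> / V + C / V / real T)"
    using eventually_gt_at_top[of 0]
  proof eventually_elim
    case (elim T)
    have "0 \<le> (\<integral>\<omega>. (norm (Q T \<omega>))\<^sup>2 \<partial>M)" by (intro integral_nonneg_AE) auto
    with bound[of T] have "V * (\<Sum>t<T. \<Sum>n\<in>UNIV. \<integral>\<omega>. y n t \<omega> \<partial>M) \<le> \<kappa> * real T + C" by linarith
    then show ?case using elim V by (simp add: field_simps)
  qed
  then have "avg_penalty M y \<le> limsup (\<lambda>T. ereal (\<kappa> / V + C / V / real T))"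
    unfolding avg_penalty_def by (rule Limsup_mono)
  also have "\<dots> = ereal (\<kappa> / V + 0)"
    by (intro lim_imp_Limsup[OF sequentially_bot] tendsto_ereal tendsto_add tendsto_const lim_const_over_n)
  finally show ?thesis by simp
qed

text \<open>
  As the queue dominates the accumulated net input, it suffices that the expected queue length is of smaller
  order than \<open>T\<close>. Penalties are at least \<open>- ymax\<close>, so the hypothesis bounds the second moment of the queue
  linearly in \<open>T\<close>.
\<close>
lemma algorithm_metric:
  assumes V: "0 < V" and bound: "\<And>T. V * (\<Sum>t<T. \<Sum>n\<in>UNIV. \<integral>\<omega>. y n t \<omega> \<partial>M) +
      (\<integral>\<omega>. (norm (Q T \<omega>))\<^sup>2 \<partial>M) / 4 \<le> \<kappa> * real T + C"
  shows "avg_metric M z l \<le> ereal (external_mean l)"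
proof -
  note int = integrable_price_sq[OF queue_adapted_prices] integrable_metric external_integrable
  let ?b = "\<lambda>T. 1 / real T * (\<Sum>t<T. \<Sum>n\<in>UNIV. \<integral>\<omega>. z n t \<omega> $ l \<partial>M)"
  let ?N = "real CARD('n)"
  define H where "H = 1 + 4 * (\<bar>\<kappa>\<bar> + \<bar>C\<bar> + V * (?N * ymax))"
  have sq: "(\<integral>\<omega>. (norm (Q T \<omega>))\<^sup>2 \<partial>M) \<le> (H - 1) * real T" if T: "0 < T" for T
  proof -
    have "(\<Sum>t<T. \<Sum>n\<in>(UNIV :: 'n set). - ymax) \<le> (\<Sum>t<T. \<Sum>n\<in>UNIV. \<integral>\<omega>. y n t \<omega> \<partial>M)"
    proof (intro sum_mono)
      show "- ymax \<le> (\<integral>\<omega>. y n t \<omega> \<partial>M)" for n t using penalty_expectation(2)[of n t] by linarith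
    qed
    then have "V * (\<Sum>t<T. \<Sum>n\<in>(UNIV :: 'n set). - ymax) \<le> V * (\<Sum>t<T. \<Sum>n\<in>UNIV. \<integral>\<omega>. y n t \<omega> \<partial>M)"
      using V by (intro mult_left_mono) auto
    then have "- (V * (?N * ymax) * real T) \<le> V * (\<Sum>t<T. \<Sum>n\<in>UNIV. \<integral>\<omega>. y n t \<omega> \<partial>M)"
      by (simp add: algebra_simps)
    moreover have "\<kappa> * real T \<le> \<bar>\<kappa>\<bar> * real T" by (intro mult_right_mono) auto
    moreover have "C \<le> \<bar>C\<bar> * real T" using T mult_left_mono[of 1 "real T" "\<bar>C\<bar>"] by linarith
    ultimately have "(\<integral>\<omega>. (norm (Q T \<omega>))\<^sup>2 \<partial>M) / 4 \<le> \<bar>\<kappa>\<bar> * real T + \<bar>C\<bar> * real T + V * (?N * ymax) * real T"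
      using bound[of T] by linarith
    then show ?thesis by (simp add: H_def algebra_simps)
  qed
  have queue: "(\<integral>\<omega>. Q T \<omega> $ l \<partial>M) \<le> H * sqrt (real T)" if T: "0 < T" for T
  proof -
    let ?s = "sqrt (real T)"
    have s: "0 < ?s" using T by simp
    \<comment> \<open>Balanced for \<open>x\<close> of order \<open>\<surd>T\<close>, the order of the queue in mean square.\<close>
    have "x \<le> ?s + x\<^sup>2 / ?s" for x
    proof (cases "x \<le> ?s")
      case True
      then show ?thesis using s by (simp add: add_increasing2)
    next
      case False
      then have "?s \<le> x" "0 \<le> x" using s by linarith+
      then have "x * ?s \<le> x\<^sup>2" using mult_left_mono[of ?s x x] by (simp add: power2_eq_square)
      then have "x \<le> x\<^sup>2 / ?s" using s by (simp add: pos_le_divide_eq)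
      then show ?thesis using s by linarith
    qed
    moreover have "(q $ l)\<^sup>2 / ?s \<le> (norm q)\<^sup>2 / ?s" for q :: "real ^ 'l"
      using s power_mono[OF component_le_norm_cart[of q l], of 2] by (intro divide_right_mono) auto
    ultimately have "Q T \<omega> $ l \<le> ?s + (norm (Q T \<omega>))\<^sup>2 / ?s" for \<omega>
      by (rule order_trans[OF _ add_left_mono])
    then have "(\<integral>\<omega>. Q T \<omega> $ l \<partial>M) \<le> (\<integral>\<omega>. ?s + (norm (Q T \<omega>))\<^sup>2 / ?s \<partial>M)"
      using int by (intro integral_mono) auto
    also have "\<dots> = ?s + (\<integral>\<omega>. (norm (Q T \<omega>))\<^sup>2 \<partial>M) / ?s" using int by (simp add: prob_space)
    also have "\<dots> \<le> ?s + (H - 1) * real T / ?s"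
      using s by (intro add_left_mono divide_right_mono sq T) auto
    also have "(H - 1) * real T / ?s = (H - 1) * ?s"
      using s by (simp add: field_simps)
    finally show ?thesis by (simp add: algebra_simps)
  qed
  have "\<forall>\<^sub>F T in sequentially. ereal (?b T) \<le> ereal (external_mean l + H / sqrt (real T))"
    using eventually_gt_at_top[of 0]
  proof eventually_elim
    case (elim T)
    have "(\<integral>\<omega>. (\<Sum>t<T. (\<Sum>n\<in>UNIV. z n t \<omega> $ l) - d t \<omega> $ l) \<partial>M) \<le> (\<integral>\<omega>. Q T \<omega> $ l \<partial>M)"
      using int queue_ge_net_input by (intro integral_mono) auto
    then have "(\<Sum>t<T. \<Sum>n\<in>UNIV. \<integral>\<omega>. z n t \<omega> $ l \<partial>M) - real T * external_mean l \<le> H * sqrt (real T)"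
      using int queue[OF elim] by (simp add: external_expectation sum_subtractf)
    then have "?b T \<le> external_mean l + H * sqrt (real T) / real T"
      using elim by (simp add: field_simps)
    also have "H * sqrt (real T) / real T = H / sqrt (real T)"
      using elim by (simp add: field_simps)
    finally show ?case by simp
  qed
  then have "avg_metric M z l \<le> limsup (\<lambda>T. ereal (external_mean l + H / sqrt (real T)))"
    unfolding avg_metric_def by (rule Limsup_mono)
  also have "\<dots> = ereal (external_mean l + 0)"
    by (intro lim_imp_Limsup[OF sequentially_bot] tendsto_ereal tendsto_add tendsto_const tendsto_divide_0[OF tendsto_const]
        filterlim_at_top_imp_at_infinity filterlim_compose[OF sqrt_at_top filterlim_real_sequentially])
  finally show ?thesis by simp
qed

end

theorem theorem3p2:
  fixes A :: "'n::finite \<Rightarrow> 'a measure"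
    and K :: "'n \<Rightarrow> nat \<Rightarrow> 'a \<Rightarrow> 'l::finite frame measure"
    and D :: "(real ^ 'l) measure"
    and M :: "'w measure"
    and F :: "nat \<Rightarrow> 'w measure"
    and \<tau> :: "'n \<Rightarrow> nat \<Rightarrow> 'w \<Rightarrow> nat"
    and \<alpha> :: "'n \<Rightarrow> nat \<Rightarrow> 'w \<Rightarrow> 'a"
    and y :: "'n \<Rightarrow> nat \<Rightarrow> 'w \<Rightarrow> real"
    and z :: "'n \<Rightarrow> nat \<Rightarrow> 'w \<Rightarrow> real ^ 'l"
    and d :: "nat \<Rightarrow> 'w \<Rightarrow> real ^ 'l"
    and V ymax zmax dmax B C1 C3 :: real
  assumes systems: "renewal_systems A K D"
    and feasible: "feasible_values TYPE('v) A K D \<noteq> {}"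
    and bounded: "bounded_systems A K D ymax zmax dmax B"
    and compact: "compact_rates A K"
    and V: "V > 0"
    and run: "decision_sequence A K D M F \<tau> \<alpha> y z d"
    and algorithm: "proposed_algorithm V A K M \<tau> \<alpha> z d"
    and C1: "C1 = 6 * real CARD('l) * zmax * (real CARD('n) * zmax + dmax) * B"
    and C3: "C3 = 1 / 2 * (real CARD('n) * zmax + dmax)\<^sup>2 * real CARD('l)"
  shows "(\<forall>l. limsup (\<lambda>T. ereal (1 / real T * (\<Sum>t<T. \<Sum>n\<in>UNIV. (\<integral>\<omega>. z n t \<omega> $ l \<partial>M))))
             \<le> ereal (\<integral>x. x $ l \<partial>D)) \<and>
         limsup (\<lambda>T. ereal (1 / real T * (\<Sum>t<T. \<Sum>n\<in>UNIV. (\<integral>\<omega>. y n t \<omega> \<partial>M))))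
             \<le> opt_value TYPE('v) A K D + ereal ((real CARD('n) * C1 + C3) / V)"
proof -
  interpret bounded_decision_sequence A K D M F \<tau> \<alpha> y z d ymax zmax dmax B
    using run bounded by (intro bounded_decision_sequence.intro bounded_decision_sequence_axioms.intro)
  let ?gap = "(real CARD('n) * C1 + C3) / V"
  define \<kappa> where "\<kappa> r = V * r + real CARD('n) *
      (2 * zmax * (real CARD('l) * (real CARD('n) * zmax + dmax)) * B) +
      (real CARD('n) * zmax + dmax)\<^sup>2 * real CARD('l) / 2" for r
  \<comment> \<open>The price drift inside frames takes up only a third of \<open>C1\<close>.\<close>
  have \<kappa>: "\<kappa> r / V \<le> r + ?gap" for r
  proof -
    have "0 \<le> zmax * (real CARD('l) * (real CARD('n) * zmax + dmax)) * B"
      using zmax_nonneg net_input_bound_nonneg B_ge_1 by simp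
    then have "2 * zmax * (real CARD('l) * (real CARD('n) * zmax + dmax)) * B \<le> C1"
      unfolding C1 by (simp add: algebra_simps)
    then have "real CARD('n) * (2 * zmax * (real CARD('l) * (real CARD('n) * zmax + dmax)) * B)
        \<le> real CARD('n) * C1"
      by (intro mult_left_mono) auto
    then have "\<kappa> r \<le> V * r + (real CARD('n) * C1 + C3)" by (simp add: \<kappa>_def C3)
    then show ?thesis using V by (simp add: field_simps)
  qed
  have compare: "\<exists>C. \<forall>T. V * (\<Sum>t<T. \<Sum>n\<in>UNIV. \<integral>\<omega>. y n t \<omega> \<partial>M) +
      (\<integral>\<omega>. (norm (Q T \<omega>))\<^sup>2 \<partial>M) / 4 \<le> \<kappa> r * real T + C"
    if v: "v \<in> feasible_values TYPE('v) A K D" and r: "v < ereal r" for v r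
  proof -
    from v obtain M' :: "'v measure" and F' \<tau>' \<alpha>' y' z' d'
      where run': "decision_sequence A K D M' F' \<tau>' \<alpha>' y' z' d'"
        and feas: "constraints_satisfied D M' z'" and v_eq: "v = avg_penalty M' y'"
      unfolding feasible_values_def by blast
    interpret other: bounded_decision_sequence A K D M' F' \<tau>' \<alpha>' y' z' d' ymax zmax dmax B
      using run' bounded by (intro bounded_decision_sequence.intro bounded_decision_sequence_axioms.intro)
    have "(\<Sum>n\<in>UNIV. min_cost V A K n q) \<le> V * r + (\<Sum>l\<in>UNIV. q $ l * external_mean l)"
      if "\<And>l. 0 \<le> q $ l" for q
      using V that feas r by (intro other.min_cost_le_feasible) (auto simp: v_eq)
    from drift_plus_penalty[OF less_imp_le[OF V] algorithm this]
    show ?thesis unfolding \<kappa>_def by metis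
  qed
  have penalty: "avg_penalty M y - ereal ?gap \<le> v" if v: "v \<in> feasible_values TYPE('v) A K D" for v
  \<comment> \<open>Approximating from above by reals covers a value \<open>v\<close> that is infinite a priori.\<close>
  proof (rule dense_ge)
    fix x assume x: "v < x"
    show "avg_penalty M y - ereal ?gap \<le> x"
    proof (cases x)
      case (real r)
      then obtain C where "\<And>T. V * (\<Sum>t<T. \<Sum>n\<in>UNIV. \<integral>\<omega>. y n t \<omega> \<partial>M) +
          (\<integral>\<omega>. (norm (Q T \<omega>))\<^sup>2 \<partial>M) / 4 \<le> \<kappa> r * real T + C"
        using compare[OF v] x by blast
      from algorithm_penalty[OF V this] have "avg_penalty M y \<le> ereal (r + ?gap)"
        using \<kappa>[of r] by (meson ereal_less_eq(3) order_trans)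
      then show ?thesis using real by (simp add: ereal_minus_le)
    qed (use x in auto)
  qed
  have "avg_penalty M y - ereal ?gap \<le> opt_value TYPE('v) A K D"
    unfolding opt_value_def using penalty by (intro Inf_greatest)
  then have "avg_penalty M y \<le> opt_value TYPE('v) A K D + ereal ?gap"
    by (simp add: ereal_minus_le)
  moreover have "avg_metric M z l \<le> ereal (external_mean l)" for l
  proof -
    obtain v where v: "v \<in> feasible_values TYPE('v) A K D" using feasible by blast
    then obtain M' :: "'v measure" and F' \<tau>' \<alpha>' y' z' d'
      where run': "decision_sequence A K D M' F' \<tau>' \<alpha>' y' z' d'" and v_eq: "v = avg_penalty M' y'"
      unfolding feasible_values_def by blast
    interpret other: bounded_decision_sequence A K D M' F' \<tau>' \<alpha>' y' z' d' ymax zmax dmax B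
      using run' bounded by (intro bounded_decision_sequence.intro bounded_decision_sequence_axioms.intro)
    have "v < ereal (real CARD('n) * ymax + 1)"
      unfolding v_eq by (rule le_less_trans[OF other.avg_penalty_le_ymax]) simp
    from compare[OF v this] algorithm_metric[OF V] show ?thesis by blast
  qed
  ultimately show ?thesis unfolding avg_penalty_def avg_metric_def by blast
qed

end
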